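(* Algebraic model counting (AMC) generalizes satisfiability (SAT), model counting (#SAT), weighted model counting (WMC), probabilistic inference (PROB), sensitivity analysis (SENS), gradient (GRAD), probability of most likely states (MPE), shortest paths (S-PATH), widest paths (W-PATH), fuzzy constraints (FUZZY), $k$-weighted constraints ($k$WEIGHT), and $\mathrm{OBDD}_<$ construction. Precisely: let $T$ be a propositional theory over a finite set of variables $\mathcal V$. In each item below the structure $(\mathcal A,\oplus,\otimes,e^\oplus,e^\otimes)$ is a commutative semiring, and for every labeling function $\alpha$ of the given form the value $\mathbf A(T)$ is the solution of the named task (as described in the context). In each case $v$ ranges over $\mathcal V$. \begin{itemize} \item SAT: $(\{true,false\},\vee,\wedge,false,true)$, $\alpha(v)=\alpha(\neg v)=true$. \item #SAT: $(\mathbb N,+,\cdot,0,1)$, $\alpha(v)=\alpha(\neg v)=1$. \item WMC: $(\mathbb R_{\ge 0},+,\cdot,0,1)$, $\alpha(v),\alpha(\neg v)\in\mathbb R_{\ge 0}$. \item PROB: $(\mathbb R_{\ge 0},+,\cdot,0,1)$, $\alpha(v)\in[0,1]$, $\alpha(\neg v)=1-\alpha(v)$. \item SENS: $(\mathbb R[\mathcal V],+,\cdot,0,1)$, $\alpha(v)=v$ or $\alpha(v)\in[0,1]$, $\alpha(\neg v)=1-\alpha(v)$. \item GRAD: $(\mathbb R_{\ge 0}\times\mathbb R,\oplus,\otimes,(0,0),(1,0))$ with $(a_1,a_2)\oplus(b_1,b_2)=(a_1+b_1,a_2+b_2)$ and $(a_1,a_2)\otimes(b_1,b_2)=(a_1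 b_1,\,a_1b_2+a_2b_1)$; writing $\mathcal V=\{v_1,\dots,v_n\}$, fixing an index $k$ and numbers $p_i\in[0,1]$: $\alpha(v_k)=(p_k,1)$, $\alpha(\neg v_k)=(1-p_k,-1)$, and $\alpha(v_i)=(p_i,0)$, $\alpha(\neg v_i)=(1-p_i,0)$ for $i\ne k$. \item MPE: $(\mathbb R_{\ge 0},\max,\cdot,0,1)$, $\alpha(v)\in[0,1]$, $\alpha(\neg v)=1-\alpha(v)$. \item S-PATH: $(\mathbb N^\infty,\min,+,\infty,0)$, $\alpha(v)\in\mathbb N$, $\alpha(\neg v)=0$. \item W-PATH: $(\mathbb N^\infty,\max,\min,0,\infty)$, $\alpha(v)\in\mathbb N$, $\alpha(\neg v)=\infty$. \item FUZZY: $([0,1],\max,\min,0,1)$, $\alpha(v)\in[0,1]$, $\alpha(\neg v)=1$. \item $k$WEIGHT: $(\{0,\dots,k\},\min,+^k,k,0)$, $\alpha(v),\alpha(\neg v)\in\{0,\dots,k\}$, where $a+^k b=\min(a+b,k)$. \item $\mathrm{OBDD}_<$: $(\mathrm{OBDD}_<(\mathcal V),\vee,\wedge,\mathrm{OBDD}_<(0),\mathrm{OBDD}_<(1))$, $\alpha(v)=\mathrm{OBDD}_<(v)$, $\alpha(\neg v)=\neg\mathrm{OBDD}_<(v)$. \end{itemize}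
   Context: A semiring $(\mathcal A,\oplus,\otimes,e^\oplus,e^\otimes)$ has associative binary operations $\oplus,\otimes$ on $\mathcal A$, with $\oplus$ commutative, $\otimes$ distributing over $\oplus$, $e^\oplus$ neutral for $\oplus$, $e^\otimes$ neutral for $\otimes$, and $e^\oplus\otimes a=a\otimes e^\oplus=e^\oplus$ for all $a$. It is commutative if $\otimes$ is also commutative. AMC problem: given a propositional theory $T$ over $\mathcal V$, a commutative semiring, and a labeling function $\alpha:\mathcal L\to\mathcal A$ on the set $\mathcal L$ of literals of variables in $\mathcal V$, compute $$\mathbf A(T)=\bigoplus_{I\in\mathcal M(T)}\ \bigotimes_{l\in I}\alpha(l),$$ where $\mathcal M(T)$ is the set of models of $T$; a model is a set of literals containing exactly one of $v,\neg v$ for each $v\in\mathcal V$. Empty sums are $e^\oplus$, empty products $e^\otimes$. $\mathbb N^\infty=\mathbb N\cup\{\infty\}$ with $0\in\mathbb N$; $\mathbb R[\mathcal V]$ is the polynomial ring with the elements of $\mathcal V$ as indeterminates. $\mathrm{OBDD}_<(\mathcal V)$ is the set of (reduced, canonical) ordered binary decision diagrams over $\mathcal V$ for a fixed variable order $<$; $\mathrm{OBDD}_<(\varphi)$ is the diagram representing $\varphi$ (with $0,1$ the constants false and true), and $\vee,\wedge,\neg$ on diagrams denote the corresponding Boolean operations. Tasks: \begin{itemize} \item SAT: decide whether $T$ has a model ($true$ iff it does). \item #SAT: the number of models of $T$. \item WMC: the sum over the models of $T$ of the product of the nonnegative real weights of the model's literals. \item PROB: the probability that $T$ holds when each $v$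 is independently true with probability $\alpha(v)$. \item SENS: the probability that $T$ holds, as a polynomial in the symbolic parameters $v$ (those with $\alpha(v)=v$); i.e. the polynomial whose evaluation at any values in $[0,1]$ of the symbolic parameters is the PROB value of $T$ for these probabilities. \item GRAD: the pair $(P,\partial P/\partial p_k)$, where $P$ is the probability that $T$ holds when each $v_i$ is independently true with probability $p_i$, regarded as a polynomial in $p_1,\dots,p_n$ and evaluated at the given values. \item MPE: the maximum, over the models of $T$, of the model's probability when each $v$ is independently true with probability $\alpha(v)$ ($0$ if there is no model). \item S-PATH / W-PATH: $\mathcal V$ is the edge set of a finite directed graph with distinct nodes $s,t$, and $T$ is the disjunction over all simple $s$–$t$ paths of the conjunction of the edges of the path. S-PATH: the minimum over $s$–$t$ paths of the sum of the edge labels $\alpha(v)$ ($\infty$ if there is no path). W-PATH: the maximum over $s$–$t$ paths of the minimum edge label $\alpha(v)$ on the path ($0$ if there is no path). \item FUZZY: the maximum over models of $T$ of the minimum of the degrees $\alpha(v)$ of the variables true in the model (minimum over the empty set being $1$; value $0$ if there is no model). \item $k$WEIGHT: the minimum over models of $T$ of the total cost of the model's literals, truncated at $k$ ($k$ if there is no model). \item $\mathrm{OBDD}_<$ construction: the diagram $\mathrm{OBDD}_<(T)$. \end{itemize} *)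

theory Defs
  imports
    "HOL-Algebra.Ring"
    "HOL-Probability.Probability"
    "HOL-Library.Poly_Mapping"
    "HOL-Library.Extended_Nat"
    "Graph_Theory.Arc_Walk"
begin

datatype (atoms: 'v) form =
    FFalse
  | FVar 'v
  | FNot "'v form"
  | FAnd "'v form" "'v form"
  | FOr "'v form" "'v form"
  | FImp "'v form" "'v form"

abbreviation FTrue :: "'v form" where
  "FTrue \<equiv> FNot FFalse"

definition FConj :: "'v form list \<Rightarrow> 'v form" where
  "FConj \<phi>s = foldr FAnd \<phi>s FTrue"

definition FDisj :: "'v form list \<Rightarrow> 'v form" where
  "FDisj \<phi>s = foldr FOr \<phi>s FFalse"

fun holds :: "('v \<Rightarrow> bool) \<Rightarrow> 'v form \<Rightarrow> bool" where
  "holds \<sigma> FFalse \<longleftrightarrow> False"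
| "holds \<sigma> (FVar v) \<longleftrightarrow> \<sigma> v"
| "holds \<sigma> (FNot \<phi>) \<longleftrightarrow> \<not> holds \<sigma> \<phi>"
| "holds \<sigma> (FAnd \<phi> \<psi>) \<longleftrightarrow> holds \<sigma> \<phi> \<and> holds \<sigma> \<psi>"
| "holds \<sigma> (FOr \<phi> \<psi>) \<longleftrightarrow> holds \<sigma> \<phi> \<or> holds \<sigma> \<psi>"
| "holds \<sigma> (FImp \<phi> \<psi>) \<longleftrightarrow> (holds \<sigma> \<phi> \<longrightarrow> holds \<sigma> \<psi>)"

definition theory_over :: "'v set \<Rightarrow> 'v form set \<Rightarrow> bool" where
  "theory_over V T \<longleftrightarrow> (\<forall>\<phi>\<in>T. atoms \<phi> \<subseteq> V)"

definition theory_holds :: "'v form set \<Rightarrow> ('v \<Rightarrow> bool) \<Rightarrow> bool" where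
  "theory_holds T \<sigma> \<longleftrightarrow> (\<forall>\<phi>\<in>T. holds \<sigma> \<phi>)"

datatype 'v literal = Pos 'v | Neg 'v

definition literals :: "'v set \<Rightarrow> 'v literal set" where
  "literals V = Pos ` V \<union> Neg ` V"

definition interpretations :: "'v set \<Rightarrow> 'v literal set set" where
  "interpretations V = {I. I \<subseteq> literals V \<and> (\<forall>v\<in>V. (Pos v \<in> I) \<noteq> (Neg v \<in> I))}"

definition assignment :: "'v literal set \<Rightarrow> 'v \<Rightarrow> bool" where
  "assignment I v \<longleftrightarrow> Pos v \<in> I"

definition models :: "'v set \<Rightarrow> 'v form set \<Rightarrow> 'v literal set set" where
  "models V T = {I \<in> interpretations V. theory_holds T (assignment I)}"

locale commutative_semiring = semiring R + comm_monoid R for R (structure)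

definition amc ::
  "('a, 'm) ring_scheme \<Rightarrow> 'v set \<Rightarrow> 'v form set \<Rightarrow> ('v literal \<Rightarrow> 'a) \<Rightarrow> 'a" where
  "amc R V T \<alpha> = (\<Oplus>\<^bsub>R\<^esub>I\<in>models V T. \<Otimes>\<^bsub>R\<^esub>l\<in>I. \<alpha> l)"

definition bool_sr :: "bool ring" where
  "bool_sr = \<lparr>carrier = UNIV, monoid.mult = (\<and>), one = True, zero = False, add = (\<or>)\<rparr>"

definition nat_sr :: "nat ring" where
  "nat_sr = \<lparr>carrier = UNIV, monoid.mult = (*), one = 1, zero = 0, add = (+)\<rparr>"

definition nonneg_sr :: "real ring" where
  "nonneg_sr = \<lparr>carrier = {0..}, monoid.mult = (*), one = 1, zero = 0, add = (+)\<rparr>"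

definition grad_sr :: "(real \<times> real) ring" where
  "grad_sr = \<lparr>carrier = {0..} \<times> UNIV,
     monoid.mult = (\<lambda>(a1, a2) (b1, b2). (a1 * b1, a1 * b2 + a2 * b1)), one = (1, 0),
     zero = (0, 0), add = (\<lambda>(a1, a2) (b1, b2). (a1 + b1, a2 + b2))\<rparr>"

definition max_times_sr :: "real ring" where
  "max_times_sr = \<lparr>carrier = {0..}, monoid.mult = (*), one = 1, zero = 0, add = max\<rparr>"

definition min_plus_sr :: "enat ring" where
  "min_plus_sr = \<lparr>carrier = UNIV, monoid.mult = (+), one = 0, zero = \<infinity>, add = min\<rparr>"

definition max_min_sr :: "enat ring" where
  "max_min_sr = \<lparr>carrier = UNIV, monoid.mult = min, one = \<infinity>, zero = 0, add = max\<rparr>"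

definition fuzzy_sr :: "real ring" where
  "fuzzy_sr = \<lparr>carrier = {0..1}, monoid.mult = min, one = 1, zero = 0, add = max\<rparr>"

definition kweight_sr :: "nat \<Rightarrow> nat ring" where
  "kweight_sr k =
     \<lparr>carrier = {0..k}, monoid.mult = (\<lambda>a b. min (a + b) k), one = 0, zero = k, add = min\<rparr>"

text \<open>The joint distribution of the variables in \<open>V\<close>, each \<open>v\<close> being independently true with
  probability \<open>p v\<close>; variables outside \<open>V\<close> are false, which is the convention of
  \<open>assignment\<close> too.\<close>

definition assignment_pmf :: "'v set \<Rightarrow> ('v \<Rightarrow> real) \<Rightarrow> ('v \<Rightarrow> bool) pmf" where
  "assignment_pmf V p = Pi_pmf V False (\<lambda>v. bernoulli_pmf (p v))"

definition prob_holds :: "'v set \<Rightarrow> 'v form set \<Rightarrow> ('v \<Rightarrow> real) \<Rightarrow> real" where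
  "prob_holds V T p = measure_pmf.prob (assignment_pmf V p) {\<sigma>. theory_holds T \<sigma>}"

definition mpe_value :: "'v set \<Rightarrow> 'v form set \<Rightarrow> ('v \<Rightarrow> real) \<Rightarrow> real" where
  "mpe_value V T p =
     (if models V T = {} then 0
      else Max ((\<lambda>I. pmf (assignment_pmf V p) (assignment I)) ` models V T))"

text \<open>A monomial maps each indeterminate to its exponent, a polynomial maps each monomial to its
  coefficient, both with finite support. Multiplication of \<open>poly_mapping\<close> is convolution.\<close>

type_synonym 'v mpoly = "('v \<Rightarrow>\<^sub>0 nat) \<Rightarrow>\<^sub>0 real"

definition polys :: "'v set \<Rightarrow> 'v mpoly set" where
  "polys V = {q. \<forall>m\<in>Poly_Mapping.keys q. Poly_Mapping.keys m \<subseteq> V}"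

definition pvar :: "'v \<Rightarrow> 'v mpoly" where
  "pvar v = Poly_Mapping.single (Poly_Mapping.single v 1) 1"

definition pconst :: "real \<Rightarrow> 'v mpoly" where
  "pconst c = Poly_Mapping.single 0 c"

definition peval :: "('v \<Rightarrow> real) \<Rightarrow> 'v mpoly \<Rightarrow> real" where
  "peval \<theta> q = (\<Sum>m\<in>Poly_Mapping.keys q. Poly_Mapping.lookup q m *
                 (\<Prod>v\<in>Poly_Mapping.keys m. \<theta> v ^ Poly_Mapping.lookup m v))"

definition poly_sr :: "'v set \<Rightarrow> 'v mpoly ring" where
  "poly_sr V = \<lparr>carrier = polys V, monoid.mult = (*), one = 1, zero = 0, add = (+)\<rparr>"

text \<open>\<open>q\<close> is the probability that \<open>T\<close> holds, as a polynomial in the symbolic parameters \<open>S\<close>,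
  where the variables in \<open>V - S\<close> have the fixed probabilities \<open>p\<close>.\<close>

definition is_prob_poly ::
  "'v set \<Rightarrow> 'v form set \<Rightarrow> 'v set \<Rightarrow> ('v \<Rightarrow> real) \<Rightarrow> 'v mpoly \<Rightarrow> bool" where
  "is_prob_poly V T S p q \<longleftrightarrow>
     q \<in> polys S \<and>
     (\<forall>\<theta>. (\<forall>v\<in>S. \<theta> v \<in> {0..1}) \<longrightarrow>
        peval \<theta> q = prob_holds V T (\<lambda>v. if v \<in> S then \<theta> v else p v))"

text \<open>The derivative is that of the polynomial function, so it is two-sided also when
  \<open>p k\<close> is \<open>0\<close> or \<open>1\<close>.\<close>

definition is_prob_grad ::
  "'v set \<Rightarrow> 'v form set \<Rightarrow> ('v \<Rightarrow> real) \<Rightarrow> 'v \<Rightarrow> real \<times> real \<Rightarrow> bool" where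
  "is_prob_grad V T p k ab \<longleftrightarrow>
     (\<exists>!q. is_prob_poly V T V p q) \<and>
     (\<forall>q. is_prob_poly V T V p q \<longrightarrow>
        fst ab = peval p q \<and>
        ((\<lambda>x. peval (p(k := x)) q) has_real_derivative snd ab) (at (p k)))"

text \<open>The edges themselves are the propositional variables. The disjunction is taken in an
  arbitrary order of the simple paths.\<close>

definition is_path_theory ::
  "('n, 'v) pre_digraph \<Rightarrow> 'n \<Rightarrow> 'n \<Rightarrow> 'v form set \<Rightarrow> bool" where
  "is_path_theory G s t T \<longleftrightarrow>
     (\<exists>ps. distinct ps \<and> set ps = {p. pre_digraph.apath G s p t} \<and>
           T = {FDisj (map (\<lambda>p. FConj (map FVar p)) ps)})"

text \<open>On \<open>enat\<close>, \<open>Inf\<close> of a non-empty set and \<open>Sup\<close> of a finite non-empty set are its minimum and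
  maximum, \<open>Inf {} = \<infinity>\<close> and \<open>Sup {} = 0\<close>. A set of walks may be infinite, but
  its bottlenecks are among the finitely many edge labels.\<close>

definition shortest :: "'v list set \<Rightarrow> ('v \<Rightarrow> enat) \<Rightarrow> enat" where
  "shortest P w = (INF p\<in>P. sum_list (map w p))"

definition widest :: "'v list set \<Rightarrow> ('v \<Rightarrow> enat) \<Rightarrow> enat" where
  "widest P w = (SUP p\<in>P. Min (w ` set p))"

definition fuzzy_degree :: "'v literal set \<Rightarrow> ('v \<Rightarrow> real) \<Rightarrow> real" where
  "fuzzy_degree I d =
     (if {v. Pos v \<in> I} = {} then 1 else Min (d ` {v. Pos v \<in> I}))"

definition fuzzy_value :: "'v set \<Rightarrow> 'v form set \<Rightarrow> ('v \<Rightarrow> real) \<Rightarrow> real" where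
  "fuzzy_value V T d =
     (if models V T = {} then 0 else Max ((\<lambda>I. fuzzy_degree I d) ` models V T))"

definition kweight_value :: "nat \<Rightarrow> 'v set \<Rightarrow> 'v form set \<Rightarrow> ('v literal \<Rightarrow> nat) \<Rightarrow> nat" where
  "kweight_value k V T c =
     (if models V T = {} then k else min (Min ((\<lambda>I. \<Sum>l\<in>I. c l) ` models V T)) k)"

text \<open>A diagram is represented by its unfolding \<open>Node v low high\<close>: in a reduced diagram distinct
  nodes root non-isomorphic subdiagrams, so its nodes are exactly the distinct
  subterms of the unfolding. What remains of reducedness is the absence of redundant tests.
  The pair \<open>(u, v)\<close> is in \<open>r\<close> iff \<open>u\<close> is tested before \<open>v\<close>.\<close>

datatype (bdd_vars: 'v) bdd = Leaf bool | Node 'v "'v bdd" "'v bdd"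

fun bdd_eval :: "'v bdd \<Rightarrow> ('v \<Rightarrow> bool) \<Rightarrow> bool" where
  "bdd_eval (Leaf b) \<sigma> = b"
| "bdd_eval (Node v l h) \<sigma> = (if \<sigma> v then bdd_eval h \<sigma> else bdd_eval l \<sigma>)"

fun bdd_ordered :: "('v \<times> 'v) set \<Rightarrow> 'v bdd \<Rightarrow> bool" where
  "bdd_ordered r (Leaf b) \<longleftrightarrow> True"
| "bdd_ordered r (Node v l h) \<longleftrightarrow>
     (\<forall>u \<in> bdd_vars l \<union> bdd_vars h. (v, u) \<in> r) \<and> bdd_ordered r l \<and> bdd_ordered r h"

fun bdd_reduced :: "'v bdd \<Rightarrow> bool" where
  "bdd_reduced (Leaf b) \<longleftrightarrow> True"
| "bdd_reduced (Node v l h) \<longleftrightarrow> l \<noteq> h \<and> bdd_reduced l \<and> bdd_reduced h"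

definition obdds :: "('v \<times> 'v) set \<Rightarrow> 'v set \<Rightarrow> 'v bdd set" where
  "obdds r V = {d. bdd_vars d \<subseteq> V \<and> bdd_ordered r d \<and> bdd_reduced d}"

definition obdd :: "('v \<times> 'v) set \<Rightarrow> 'v set \<Rightarrow> (('v \<Rightarrow> bool) \<Rightarrow> bool) \<Rightarrow> 'v bdd" where
  "obdd r V f = (THE d. d \<in> obdds r V \<and> bdd_eval d = f)"

definition obdd_or :: "('v \<times> 'v) set \<Rightarrow> 'v set \<Rightarrow> 'v bdd \<Rightarrow> 'v bdd \<Rightarrow> 'v bdd" where
  "obdd_or r V d e = obdd r V (\<lambda>\<sigma>. bdd_eval d \<sigma> \<or> bdd_eval e \<sigma>)"

definition obdd_and :: "('v \<times> 'v) set \<Rightarrow> 'v set \<Rightarrow> 'v bdd \<Rightarrow> 'v bdd \<Rightarrow> 'v bdd" where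
  "obdd_and r V d e = obdd r V (\<lambda>\<sigma>. bdd_eval d \<sigma> \<and> bdd_eval e \<sigma>)"

definition obdd_not :: "('v \<times> 'v) set \<Rightarrow> 'v set \<Rightarrow> 'v bdd \<Rightarrow> 'v bdd" where
  "obdd_not r V d = obdd r V (\<lambda>\<sigma>. \<not> bdd_eval d \<sigma>)"

definition obdd_sr :: "('v \<times> 'v) set \<Rightarrow> 'v set \<Rightarrow> 'v bdd ring" where
  "obdd_sr r V = \<lparr>carrier = obdds r V, monoid.mult = obdd_and r V, one = obdd r V (\<lambda>_. True),
     zero = obdd r V (\<lambda>_. False), add = obdd_or r V\<rparr>"

text \<open>Canonicity: \<open>obdd r V f\<close> is well defined for every Boolean function \<open>f\<close> of the
  variables in \<open>V\<close>.\<close>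

lemma bdd_eval_cong:
  "(\<And>v. v \<in> bdd_vars d \<Longrightarrow> \<sigma> v = \<tau> v) \<Longrightarrow> bdd_eval d \<sigma> = bdd_eval d \<tau>"
  by (induction d) auto

lemma bdd_eval_upd_notin:
  "v \<notin> bdd_vars d \<Longrightarrow> bdd_eval d (\<sigma>(v := b)) = bdd_eval d \<sigma>"
  by (rule bdd_eval_cong) auto

lemma Node_in_obdds:
  "Node v l h \<in> obdds r V \<longleftrightarrow>
     v \<in> V \<and> (\<forall>u \<in> bdd_vars l \<union> bdd_vars h. (v, u) \<in> r) \<and> l \<noteq> h \<and>
     l \<in> obdds r V \<and> h \<in> obdds r V"
  by (auto simp: obdds_def)

lemma obdd_unique:
  assumes r: "strict_linear_order_on V r"
  shows "d \<in> obdds r V \<Longrightarrow> e \<in> obdds r V \<Longrightarrow> bdd_eval d = bdd_eval e \<Longrightarrow> d = e"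
proof (induction "size d + size e" arbitrary: d e rule: less_induct)
  case less
  have irr: "(v, v) \<notin> r" for v
    using r by (auto simp: strict_linear_order_on_def irrefl_def)
  have tr: "(a, b) \<in> r \<Longrightarrow> (b, c) \<in> r \<Longrightarrow> (a, c) \<in> r" for a b c
    using r by (auto simp: strict_linear_order_on_def dest: transD)
  have asym: "(a, b) \<in> r \<Longrightarrow> (b, a) \<notin> r" for a b
    using irr tr by blast
  have tot: "a \<in> V \<Longrightarrow> b \<in> V \<Longrightarrow> a = b \<or> (a, b) \<in> r \<or> (b, a) \<in> r" for a b
    using r by (auto simp: strict_linear_order_on_def total_on_def)
  have redundant: False
    if n: "Node v l h \<in> obdds r V" and nv: "v \<notin> bdd_vars g"
      and ev: "bdd_eval (Node v l h) = bdd_eval g"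
      and sz: "size (Node v l h) \<le> size d + size e" for v l h g
  proof -
    have vn: "v \<notin> bdd_vars l" "v \<notin> bdd_vars h"
      using n irr unfolding Node_in_obdds by blast+
    have "bdd_eval l \<sigma> = bdd_eval h \<sigma>" for \<sigma>
      using fun_cong[OF ev, of "\<sigma>(v := False)"] fun_cong[OF ev, of "\<sigma>(v := True)"]
      by (simp add: bdd_eval_upd_notin vn nv)
    hence "bdd_eval l = bdd_eval h" by auto
    moreover have "l \<in> obdds r V" "h \<in> obdds r V" using n by (auto simp: obdds_def)
    ultimately have "l = h" using less.hyps[of l h] sz by simp
    thus False using n by (simp add: obdds_def)
  qed
  show ?case
  proof (cases d)
    case (Leaf b)
    show ?thesis
    proof (cases e)
      case (Leaf c)
      thus ?thesis using \<open>d = Leaf b\<close> fun_cong[OF less.prems(3), of undefined] by simp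
    next
      case (Node w l' h')
      thus ?thesis using redundant[of w l' h' d] less.prems \<open>d = Leaf b\<close> by simp
    qed
  next
    case d: (Node v l h)
    show ?thesis
    proof (cases e)
      case (Leaf c)
      thus ?thesis using redundant[of v l h e] less.prems d by simp
    next
      case e: (Node w l' h')
      have V: "v \<in> V" "w \<in> V" using less.prems d e by (auto simp: obdds_def)
      consider "v = w" | "(v, w) \<in> r" | "(w, v) \<in> r" using tot[OF V] by blast
      thus ?thesis
      proof cases
        case 1
        have vn: "w \<notin> bdd_vars l" "w \<notin> bdd_vars h" "w \<notin> bdd_vars l'" "w \<notin> bdd_vars h'"
          using less.prems(1,2) irr unfolding d e 1 Node_in_obdds by blast+
        have "bdd_eval l \<sigma> = bdd_eval l' \<sigma>" for \<sigma>
          using fun_cong[OF less.prems(3), of "\<sigma>(v := False)"] d e 1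
          by (simp add: bdd_eval_upd_notin vn)
        moreover have "bdd_eval h \<sigma> = bdd_eval h' \<sigma>" for \<sigma>
          using fun_cong[OF less.prems(3), of "\<sigma>(v := True)"] d e 1
          by (simp add: bdd_eval_upd_notin vn)
        moreover have "l \<in> obdds r V" "h \<in> obdds r V" "l' \<in> obdds r V" "h' \<in> obdds r V"
          using less.prems d e by (auto simp: obdds_def)
        ultimately have "l = l'" "h = h'"
          using less.hyps[of l l'] less.hyps[of h h'] d e by auto
        thus ?thesis using d e 1 by simp
      next
        case 2
        hence "v \<notin> bdd_vars e"
          using less.prems(2) irr asym unfolding e Node_in_obdds bdd.set by blast
        thus ?thesis using redundant[of v l h e] less.prems d by simp
      next
        case 3
        hence "w \<notin> bdd_vars d"
          using less.prems(1) irr asym unfolding d Node_in_obdds bdd.set by blast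
        thus ?thesis using redundant[of w l' h' d] less.prems e by simp
      qed
    qed
  qed
qed

lemma obdd_exists:
  assumes "finite W" and "W \<subseteq> V" and r: "strict_linear_order_on V r"
    and "\<And>\<sigma> \<tau>. (\<forall>v\<in>W. \<sigma> v = \<tau> v) \<Longrightarrow> f \<sigma> = f \<tau>"
  shows "\<exists>d. d \<in> obdds r W \<and> bdd_eval d = f"
  using assms(1,2,4)
proof (induction "card W" arbitrary: W f)
  case 0
  hence c: "f undefined = f \<sigma>" for \<sigma> by simp
  have "bdd_eval (Leaf (f undefined)) = f"
    by (rule ext) (use c in \<open>unfold bdd_eval.simps, blast\<close>)
  moreover have "Leaf (f undefined) \<in> obdds r W" by (simp add: obdds_def)
  ultimately show ?case by blast
next
  case (Suc n)
  have "acyclic (r \<inter> W \<times> W)"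
  proof (rule acyclic_subset)
    show "acyclic r" using r by (simp add: strict_linear_order_on_def acyclic_irrefl)
  qed auto
  hence "wf (r \<inter> W \<times> W)" using Suc.prems(1) by (simp add: finite_acyclic_wf)
  moreover have "W \<noteq> {}" using Suc.hyps(2) by auto
  ultimately obtain m where m: "m \<in> W" "\<And>u. (u, m) \<in> r \<inter> W \<times> W \<Longrightarrow> u \<notin> W"
    using wfE_min'[of "r \<inter> W \<times> W" W] by blast
  have min: "(m, u) \<in> r" if "u \<in> W - {m}" for u
    using that m r Suc.prems(2) unfolding strict_linear_order_on_def total_on_def by blast
  have "\<exists>d. d \<in> obdds r (W - {m}) \<and> bdd_eval d = (\<lambda>\<sigma>. f (\<sigma>(m := b)))" for b
  proof (rule Suc.hyps(1))
    show "n = card (W - {m})" using Suc.hyps(2) m(1) Suc.prems(1) by simp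
    show "finite (W - {m})" "W - {m} \<subseteq> V" using Suc.prems by auto
    show "f (\<sigma>(m := b)) = f (\<tau>(m := b))" if "\<forall>v\<in>W - {m}. \<sigma> v = \<tau> v" for \<sigma> \<tau>
      using that by (intro Suc.prems(3)) auto
  qed
  then obtain l h where l: "l \<in> obdds r (W - {m})" "bdd_eval l = (\<lambda>\<sigma>. f (\<sigma>(m := False)))"
    and h: "h \<in> obdds r (W - {m})" "bdd_eval h = (\<lambda>\<sigma>. f (\<sigma>(m := True)))" by metis
  have ev: "bdd_eval (Node m l h) = f"
    by (rule ext) (auto simp: l(2) h(2) fun_upd_idem)
  show ?case
  proof (cases "l = h")
    case True
    hence "bdd_eval l = f" using ev by (auto simp: fun_eq_iff)
    thus ?thesis using l(1) by (auto simp: obdds_def)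
  next
    case False
    hence "Node m l h \<in> obdds r W" using l(1) h(1) m(1) min by (auto simp: obdds_def)
    thus ?thesis using ev by blast
  qed
qed

lemma obdd_canonical:
  assumes "finite V" and "strict_linear_order_on V r"
    and "\<And>\<sigma> \<tau>. (\<forall>v\<in>V. \<sigma> v = \<tau> v) \<Longrightarrow> f \<sigma> = f \<tau>"
  shows "\<exists>!d. d \<in> obdds r V \<and> bdd_eval d = f"
proof -
  obtain d where d: "d \<in> obdds r V" "bdd_eval d = f"
    using obdd_exists[where W = V and V = V and f = f and r = r] assms by blast
  show ?thesis
  proof (rule ex1I[of _ d])
    show "d \<in> obdds r V \<and> bdd_eval d = f" using d by simp
    show "e = d" if "e \<in> obdds r V \<and> bdd_eval e = f" for e
      using obdd_unique[OF assms(2), of e d] that d by simp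
  qed
qed

end

theory Submission
  imports Defs
begin

text \<open>A model is the same thing as an assignment of the variables in \<open>V\<close>, so a product over its
  literals is a product over \<open>V\<close>. In each semiring the iterated operations have a closed form.
  For probabilities the product is the point mass of the assignment. The sensitivity polynomial
  is unique since a polynomial that vanishes on the unit cube is zero, and the gradient semiring
  computes with dual numbers. For paths, the models of the theory are the edge sets containing a
  simple path; deleting edges outside the path, or cycles of a walk, never makes the value worse.
  OBDDs are determined by the Boolean function that they evaluate to, which turns the semiring
  laws and the computation into statements about Boolean functions.\<close>

section \<open>Evaluation in a commutative semiring\<close>

text \<open>\<open>amc\<close> is built from the record-based folds \<open>finsum\<close> and
  \<open>finprod\<close>, whereas the tasks are phrased with native operations such as
  \<open>Max\<close>, \<open>INF\<close> or \<open>\<Sum>\<close>. The bridge is a pair of set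
  functions that obey the insertion equations of the two folds. The equations are demanded only for
  literals over \<open>V\<close>, because many carriers are proper subsets of their types and laws
  fail outside: \<open>0\<close> is neutral for \<open>max\<close> only on nonnegative reals. Two
  tasks give their answer implicitly. In SENS the polynomial is known only through its values on the
  unit cube, so the cube has to determine it. In GRAD the polynomial is the SENS answer with every
  variable symbolic, differentiated along the line on which only the parameter of \<open>k\<close>
  varies. This covers the ends of the unit interval too, where probabilities exist on one side
  only.\<close>

lemma (in comm_monoid) finprod_eqI:
  assumes "finite A" "f \<in> A \<rightarrow> carrier G" "F {} = \<one>"
    and "\<And>x B. x \<in> A \<Longrightarrow> B \<subseteq> A \<Longrightarrow> x \<notin> B \<Longrightarrow> finite B \<Longrightarrow> F (insert x B) = f x \<otimes> F B"
  shows "finprod G f A = F A"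
  using assms
proof (induction A rule: finite_induct)
  case (insert x A)
  have "F A = finprod G f A"
    using insert.prems by (intro insert.IH[symmetric]) auto
  moreover have "F (insert x A) = f x \<otimes> F A"
    using insert by (intro insert.prems(3)) auto
  ultimately show ?case using insert by simp
qed simp

lemmas (in abelian_monoid) finsum_eqI = add.finprod_eqI[folded finsum_def]

text \<open>Commutativity of both operations supplies the other side of each one-sided law.\<close>

lemma commutative_semiringI:
  fixes R (structure)
  assumes "\<zero> \<in> carrier R" "\<one> \<in> carrier R"
    and "\<And>x y. x \<in> carrier R \<Longrightarrow> y \<in> carrier R \<Longrightarrow> x \<oplus> y \<in> carrier R"
    and "\<And>x y. x \<in> carrier R \<Longrightarrow> y \<in> carrier R \<Longrightarrow> x \<otimes> y \<in> carrier R"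
    and "\<And>x y. x \<in> carrier R \<Longrightarrow> y \<in> carrier R \<Longrightarrow> x \<oplus> y = y \<oplus> x"
    and "\<And>x y. x \<in> carrier R \<Longrightarrow> y \<in> carrier R \<Longrightarrow> x \<otimes> y = y \<otimes> x"
    and "\<And>x y z. x \<in> carrier R \<Longrightarrow> y \<in> carrier R \<Longrightarrow> z \<in> carrier R \<Longrightarrow>
           (x \<oplus> y) \<oplus> z = x \<oplus> (y \<oplus> z)"
    and "\<And>x y z. x \<in> carrier R \<Longrightarrow> y \<in> carrier R \<Longrightarrow> z \<in> carrier R \<Longrightarrow>
           (x \<otimes> y) \<otimes> z = x \<otimes> (y \<otimes> z)"
    and "\<And>x. x \<in> carrier R \<Longrightarrow> \<zero> \<oplus> x = x"
    and "\<And>x. x \<in> carrier R \<Longrightarrow> \<one> \<otimes> x = x"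
    and "\<And>x y z. x \<in> carrier R \<Longrightarrow> y \<in> carrier R \<Longrightarrow> z \<in> carrier R \<Longrightarrow>
           (x \<oplus> y) \<otimes> z = x \<otimes> z \<oplus> y \<otimes> z"
    and "\<And>x. x \<in> carrier R \<Longrightarrow> \<zero> \<otimes> x = \<zero>"
  shows "commutative_semiring R"
proof -
  interpret comm_monoid R
    by (rule comm_monoidI) (use assms in auto)
  interpret abelian_monoid R
    by (rule abelian_monoidI) (use assms in auto)
  show ?thesis
  proof unfold_locales
    show "z \<otimes> (x \<oplus> y) = z \<otimes> x \<oplus> z \<otimes> y"
      if "x \<in> carrier R" "y \<in> carrier R" "z \<in> carrier R" for x y z
      using that assms by (metis (no_types, lifting))
  qed (use assms in \<open>auto simp: m_comm\<close>)
qed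

section \<open>Semiring laws of the numeric structures\<close>

lemma commutative_semiring_bool: "commutative_semiring bool_sr"
  by (rule commutative_semiringI) (auto simp: bool_sr_def)

lemma commutative_semiring_nat: "commutative_semiring nat_sr"
  by (rule commutative_semiringI) (auto simp: nat_sr_def algebra_simps)

lemma commutative_semiring_nonneg: "commutative_semiring nonneg_sr"
  by (rule commutative_semiringI) (auto simp: nonneg_sr_def algebra_simps)

lemma commutative_semiring_grad: "commutative_semiring grad_sr"
  by (rule commutative_semiringI) (auto simp: grad_sr_def algebra_simps)

text \<open>Nonnegativity is what makes multiplication distribute over \<open>max\<close> and
  \<open>0\<close> neutral for \<open>max\<close>.\<close>

lemma commutative_semiring_max_times: "commutative_semiring max_times_sr"
  by (rule commutative_semiringI)
    (auto simp: max_times_sr_def max_mult_distrib_right max_mult_distrib_left mult_ac max.assoc intro: max.commute)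

lemma commutative_semiring_min_plus: "commutative_semiring min_plus_sr"
  by (rule commutative_semiringI)
    (auto simp: min_plus_sr_def ac_simps min_def)

lemma commutative_semiring_max_min: "commutative_semiring max_min_sr"
  by (rule commutative_semiringI)
    (auto simp: max_min_sr_def min_def max_def)

lemma commutative_semiring_fuzzy: "commutative_semiring fuzzy_sr"
  by (rule commutative_semiringI) (auto simp: fuzzy_sr_def min_def max_def)

text \<open>Both bracketings of a truncated sum equal \<open>min (x + y + z) k\<close>. The bound
  \<open>x \<le> k\<close> on the carrier makes \<open>0\<close> neutral for truncated addition and
  \<open>k\<close> neutral for \<open>min\<close>.\<close>

lemma commutative_semiring_kweight: "commutative_semiring (kweight_sr k)"
  by (rule commutative_semiringI) (auto simp: kweight_sr_def min_def)

section \<open>Interpretations as assignments\<close>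

definition signed_literal :: "('v \<Rightarrow> bool) \<Rightarrow> 'v \<Rightarrow> 'v literal" where
  "signed_literal \<sigma> v = (if \<sigma> v then Pos v else Neg v)"

lemma inj_signed_literal: "inj_on (signed_literal \<sigma>) V"
  by (auto simp: inj_on_def signed_literal_def split: if_splits)

lemma interpretation_eq_image:
  assumes "I \<in> interpretations V"
  shows "I = signed_literal (assignment I) ` V"
proof (rule Set.set_eqI)
  show "l \<in> I \<longleftrightarrow> l \<in> signed_literal (assignment I) ` V" for l
    using assms
    by (cases l) (auto simp: interpretations_def literals_def signed_literal_def assignment_def
        image_iff split: if_splits)
qed

lemma assignment_outside:
  "I \<in> interpretations V \<Longrightarrow> v \<notin> V \<Longrightarrow> \<not> assignment I v"
  by (auto simp: interpretations_def literals_def assignment_def)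

lemma signed_literal_image_in_interpretations: "signed_literal \<sigma> ` V \<in> interpretations V"
  by (auto simp: interpretations_def literals_def signed_literal_def split: if_splits)

lemma assignment_signed_literal: "assignment (signed_literal \<sigma> ` V) v \<longleftrightarrow> v \<in> V \<and> \<sigma> v"
  by (auto simp: assignment_def signed_literal_def split: if_splits)

lemma inj_on_assignment: "inj_on assignment (interpretations V)"
proof (rule inj_onI)
  fix I J assume "I \<in> interpretations V" "J \<in> interpretations V" "assignment I = assignment J"
  thus "I = J" using interpretation_eq_image[of I V] interpretation_eq_image[of J V] by simp
qed

text \<open>The right-hand side is the set that carries \<open>assignment_pmf\<close>, whose default
  outside \<open>V\<close> is \<open>False\<close>. Events can thus be counted over
  interpretations.\<close>

lemma assignment_image_interpretations:
  "assignment ` interpretations V = {\<sigma>. \<forall>v. v \<notin> V \<longrightarrow> \<not> \<sigma> v}"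
proof (intro subset_antisym subsetI)
  fix \<sigma> assume "\<sigma> \<in> {\<sigma>. \<forall>v. v \<notin> V \<longrightarrow> \<not> \<sigma> v}"
  hence "\<sigma> = assignment (signed_literal \<sigma> ` V)"
    by (auto simp: fun_eq_iff assignment_signed_literal)
  thus "\<sigma> \<in> assignment ` interpretations V"
    using signed_literal_image_in_interpretations by blast
qed (auto dest: assignment_outside)

lemma finite_interpretation: "finite V \<Longrightarrow> I \<in> interpretations V \<Longrightarrow> finite I"
  by (metis interpretation_eq_image finite_imageI)

lemma finite_models: "finite V \<Longrightarrow> finite (models V T)"
  by (rule finite_subset[of _ "Pow (literals V)"])
    (auto simp: models_def interpretations_def literals_def)

lemma models_subset: "models V T \<subseteq> interpretations V"
  by (auto simp: models_def)

lemma models_literals: "I \<in> models V T \<Longrightarrow> l \<in> I \<Longrightarrow> l \<in> literals V"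
  by (auto simp: models_def interpretations_def)

lemma holds_cong: "(\<And>v. v \<in> atoms \<phi> \<Longrightarrow> \<sigma> v = \<tau> v) \<Longrightarrow> holds \<sigma> \<phi> = holds \<tau> \<phi>"
  by (induction \<phi>) auto

lemma theory_holds_cong:
  "theory_over V T \<Longrightarrow> (\<And>v. v \<in> V \<Longrightarrow> \<sigma> v = \<tau> v) \<Longrightarrow> theory_holds T \<sigma> = theory_holds T \<tau>"
  unfolding theory_holds_def theory_over_def
  by (intro ball_cong refl holds_cong) auto

text \<open>Stated for an abstract commutative monoid so that one proof yields the versions for
  \<open>sum\<close> and for \<open>prod\<close>.\<close>

lemma (in comm_monoid_set) interpretation_F:
  assumes "I \<in> interpretations V"
  shows "F \<alpha> I = F (\<lambda>v. \<alpha> (signed_literal (assignment I) v)) V"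
  by (subst interpretation_eq_image[OF assms]) (simp add: reindex inj_signed_literal)

text \<open>The two set functions \<open>S\<close> and \<open>P\<close> are the iterated sum and product of the
  semiring in closed form.\<close>

lemma amc_eqI:
  assumes R: "commutative_semiring R" and V: "finite V"
    and \<alpha>: "\<And>l. l \<in> literals V \<Longrightarrow> \<alpha> l \<in> carrier R"
    and P: "P {} = \<one>\<^bsub>R\<^esub>"
      "\<And>l J. l \<in> literals V \<Longrightarrow> J \<subseteq> literals V \<Longrightarrow> finite J \<Longrightarrow> l \<notin> J \<Longrightarrow>
         P (insert l J) = \<alpha> l \<otimes>\<^bsub>R\<^esub> P J"
    and S: "S {} = \<zero>\<^bsub>R\<^esub>"
      "\<And>I M. I \<subseteq> literals V \<Longrightarrow> finite M \<Longrightarrow> I \<notin> M \<Longrightarrow> M \<subseteq> Pow (literals V) \<Longrightarrow>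
         S (insert I M) = P I \<oplus>\<^bsub>R\<^esub> S M"
  shows "amc R V T \<alpha> = S (models V T)"
proof -
  interpret commutative_semiring R by fact
  have prod: "finprod R \<alpha> I = P I" if "I \<in> models V T" for I
  proof (rule finprod_eqI)
    show "finite I" using that V finite_interpretation models_subset by blast
    show "\<alpha> \<in> I \<rightarrow> carrier R" by (rule Pi_I) (use that \<alpha> models_literals in blast)
    show "P (insert l J) = \<alpha> l \<otimes>\<^bsub>R\<^esub> P J" if "l \<in> I" "J \<subseteq> I" "l \<notin> J" "finite J" for l J
      using that \<open>I \<in> models V T\<close> models_literals by (intro P) blast+
  qed (rule P)
  have closed: "finprod R \<alpha> I \<in> carrier R" if "I \<in> models V T" for I
    by (rule finprod_closed, rule Pi_I) (use that \<alpha> models_literals in blast)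
  show ?thesis
    unfolding amc_def
  proof (rule finsum_eqI)
    show "finite (models V T)" using V by (rule finite_models)
    show "S (insert I M) = finprod R \<alpha> I \<oplus>\<^bsub>R\<^esub> S M"
      if "I \<in> models V T" "M \<subseteq> models V T" "I \<notin> M" "finite M" for I M
      unfolding prod[OF that(1)] using that models_literals by (intro S) blast+
  qed (use closed S in auto)
qed

section \<open>Closed forms\<close>

lemma amc_bool:
  assumes "finite V"
  shows "amc bool_sr V T \<alpha> = (\<exists>I\<in>models V T. \<forall>l\<in>I. \<alpha> l)"
  by (rule amc_eqI[where S = "\<lambda>M. \<exists>I\<in>M. \<forall>l\<in>I. \<alpha> l" and P = "\<lambda>I. \<forall>l\<in>I. \<alpha> l",
        OF commutative_semiring_bool assms])
    (auto simp: bool_sr_def)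

lemma amc_nat:
  assumes "finite V"
  shows "amc nat_sr V T \<alpha> = (\<Sum>I\<in>models V T. \<Prod>l\<in>I. \<alpha> l)"
  by (rule amc_eqI[OF commutative_semiring_nat assms]) (auto simp: nat_sr_def)

lemma amc_nonneg:
  assumes "finite V" "\<And>l. l \<in> literals V \<Longrightarrow> \<alpha> l \<ge> 0"
  shows "amc nonneg_sr V T \<alpha> = (\<Sum>I\<in>models V T. \<Prod>l\<in>I. \<alpha> l)"
  by (rule amc_eqI[OF commutative_semiring_nonneg assms(1)]) (auto simp: nonneg_sr_def assms)

lemma amc_max_times:
  assumes "finite V" "\<And>l. l \<in> literals V \<Longrightarrow> \<alpha> l \<ge> 0"
  shows "amc max_times_sr V T \<alpha> =
    (if models V T = {} then 0 else Max ((\<lambda>I. \<Prod>l\<in>I. \<alpha> l) ` models V T))"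
proof (rule amc_eqI[where S = "\<lambda>M. if M = {} then 0 else Max ((\<lambda>I. \<Prod>l\<in>I. \<alpha> l) ` M)"
      and P = "prod \<alpha>", OF commutative_semiring_max_times assms(1)])
  show "(if insert I M = {} then 0 else Max (prod \<alpha> ` insert I M)) =
      prod \<alpha> I \<oplus>\<^bsub>max_times_sr\<^esub> (if M = {} then 0 else Max (prod \<alpha> ` M))"
    if "I \<subseteq> literals V" "finite M" for I M
  proof -
    \<comment> \<open>For \<open>M = {}\<close> the right-hand side is
      \<open>max (prod \<alpha> I) 0\<close>, so the sign matters.\<close>
    have "prod \<alpha> I \<ge> 0"
      using that assms by (intro prod_nonneg) auto
    thus ?thesis using that by (auto simp: max_times_sr_def Max_insert)
  qed
qed (auto simp: max_times_sr_def assms)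

lemma amc_min_plus:
  assumes "finite V"
  shows "amc min_plus_sr V T \<alpha> = (INF I\<in>models V T. \<Sum>l\<in>I. \<alpha> l)"
  by (rule amc_eqI[where S = "\<lambda>M. INF I\<in>M. sum \<alpha> I", OF commutative_semiring_min_plus assms])
    (auto simp: min_plus_sr_def inf_min top_enat_def)

text \<open>On \<open>enat\<close> the empty infimum is \<open>\<infinity>\<close> and the empty
  supremum is \<open>0\<close>, which are exactly the two units; hence no case split on empty sets,
  in contrast to \<open>Max\<close> and \<open>Min\<close> on reals.\<close>

lemma amc_max_min:
  assumes "finite V"
  shows "amc max_min_sr V T \<alpha> = (SUP I\<in>models V T. INF l\<in>I. \<alpha> l)"
  by (rule amc_eqI[where S = "\<lambda>M. SUP I\<in>M. INF l\<in>I. \<alpha> l" and P = "\<lambda>I. INF l\<in>I. \<alpha> l",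
        OF commutative_semiring_max_min assms])
    (auto simp: max_min_sr_def inf_min sup_max top_enat_def bot_enat_def)

text \<open>Inserting the unit \<open>1\<close> gives \<open>Min\<close> a value on the empty set of
  literals and changes nothing otherwise, as labels are at most \<open>1\<close>.\<close>

lemma amc_fuzzy:
  assumes "finite V" "\<And>l. l \<in> literals V \<Longrightarrow> \<alpha> l \<in> {0..1}"
  shows "amc fuzzy_sr V T \<alpha> =
    (if models V T = {} then 0 else Max ((\<lambda>I. Min (insert 1 (\<alpha> ` I))) ` models V T))"
proof (rule amc_eqI[where S = "\<lambda>M. if M = {} then 0 else Max ((\<lambda>I. Min (insert 1 (\<alpha> ` I))) ` M)"
      and P = "\<lambda>I. Min (insert 1 (\<alpha> ` I))", OF commutative_semiring_fuzzy assms(1)])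
  show "(if insert I M = {} then 0 else Max ((\<lambda>I. Min (insert 1 (\<alpha> ` I))) ` insert I M)) =
      Min (insert 1 (\<alpha> ` I)) \<oplus>\<^bsub>fuzzy_sr\<^esub>
        (if M = {} then 0 else Max ((\<lambda>I. Min (insert 1 (\<alpha> ` I))) ` M))"
    if "I \<subseteq> literals V" "finite M" for I M
  proof -
    have "finite I"
      using that(1) by (rule finite_subset) (use assms(1) in \<open>simp add: literals_def\<close>)
    hence "Min (insert 1 (\<alpha> ` I)) \<ge> 0"
      using that assms(2) by (subst Min_ge_iff) auto
    thus ?thesis using that by (auto simp: fuzzy_sr_def Max_insert)
  qed
  show "Min (insert 1 (\<alpha> ` insert l J)) = \<alpha> l \<otimes>\<^bsub>fuzzy_sr\<^esub> Min (insert 1 (\<alpha> ` J))"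
    if "finite J" for l J
    using that by (simp add: fuzzy_sr_def insert_commute[of 1])
qed (use assms in \<open>auto simp: fuzzy_sr_def\<close>)

text \<open>Truncation at \<open>k\<close> is compatible with addition and with \<open>min\<close>,
  so truncating after every step or once at the end gives the same number.\<close>

lemma amc_kweight:
  assumes "finite V" "\<And>l. l \<in> literals V \<Longrightarrow> \<alpha> l \<in> {0..k}"
  shows "amc (kweight_sr k) V T \<alpha> = kweight_value k V T \<alpha>"
  unfolding kweight_value_def
proof (rule amc_eqI[where S = "\<lambda>M. if M = {} then k else min (Min ((\<lambda>I. \<Sum>l\<in>I. \<alpha> l) ` M)) k"
      and P = "\<lambda>I. min (\<Sum>l\<in>I. \<alpha> l) k", OF commutative_semiring_kweight assms(1)])
  show "(if insert I M = {} then k else min (Min (sum \<alpha> ` insert I M)) k) =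
      min (sum \<alpha> I) k \<oplus>\<^bsub>kweight_sr k\<^esub> (if M = {} then k else min (Min (sum \<alpha> ` M)) k)"
    if "finite M" for I M
    using that by (auto simp: kweight_sr_def Min_insert min.assoc min.left_commute)
qed (use assms in \<open>auto simp: kweight_sr_def\<close>)

lemma fuzzy_degree_eq:
  assumes V: "finite V" and I: "I \<in> interpretations V"
    and \<alpha>: "\<And>v. v \<in> V \<Longrightarrow> \<alpha> (Pos v) \<le> (1::real) \<and> \<alpha> (Neg v) = 1"
  shows "Min (insert 1 (\<alpha> ` I)) = fuzzy_degree I (\<lambda>v. \<alpha> (Pos v))"
proof -
  let ?A = "{v. Pos v \<in> I}"
  have A: "?A \<subseteq> V" "finite ?A"
    using I V finite_subset[of ?A V] by (auto simp: interpretations_def literals_def)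
  have "insert 1 (\<alpha> ` I) = insert 1 ((\<lambda>v. \<alpha> (Pos v)) ` ?A)"
  proof -
    have "\<alpha> l = 1 \<or> l \<in> Pos ` ?A" if "l \<in> I" for l
      using that \<alpha> I by (cases l) (auto simp: interpretations_def literals_def)
    thus ?thesis by fastforce
  qed
  moreover have "Min (insert 1 ((\<lambda>v. \<alpha> (Pos v)) ` ?A)) = Min ((\<lambda>v. \<alpha> (Pos v)) ` ?A)" if ne: "?A \<noteq> {}"
  proof -
    have "Min ((\<lambda>v. \<alpha> (Pos v)) ` ?A) \<le> 1"
      using A \<alpha> ne by (subst Min_le_iff) auto
    thus ?thesis using A ne by (simp add: Min_insert min_absorb2)
  qed
  ultimately show ?thesis by (auto simp: fuzzy_degree_def)
qed

lemma amc_fuzzy_value: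
  assumes "finite V" "\<And>v. v \<in> V \<Longrightarrow> \<alpha> (Pos v) \<in> {0..1} \<and> \<alpha> (Neg v) = 1"
  shows "amc fuzzy_sr V T \<alpha> = fuzzy_value V T (\<lambda>v. \<alpha> (Pos v))"
proof -
  have "amc fuzzy_sr V T \<alpha> =
      (if models V T = {} then 0 else Max ((\<lambda>I. Min (insert 1 (\<alpha> ` I))) ` models V T))"
    using assms by (intro amc_fuzzy) (auto simp: literals_def)
  moreover have "Min (insert 1 (\<alpha> ` I)) = fuzzy_degree I (\<lambda>v. \<alpha> (Pos v))" if "I \<in> models V T" for I
    using that assms models_subset by (intro fuzzy_degree_eq[OF assms(1)]) auto
  ultimately show ?thesis by (simp add: fuzzy_value_def cong: image_cong)
qed

section \<open>Probability\<close>

lemma pmf_assignment: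
  assumes V: "finite V" and I: "I \<in> interpretations V"
    and p: "\<And>v. v \<in> V \<Longrightarrow> p v \<in> {0..1}"
    and \<alpha>: "\<And>v. v \<in> V \<Longrightarrow> \<alpha> (Pos v) = p v \<and> \<alpha> (Neg v) = 1 - p v"
  shows "pmf (assignment_pmf V p) (assignment I) = (\<Prod>l\<in>I. \<alpha> l)"
proof -
  have "pmf (assignment_pmf V p) (assignment I) =
      (\<Prod>v\<in>V. pmf (bernoulli_pmf (p v)) (assignment I v))"
    \<comment> \<open>The mass factorizes because \<open>assignment I\<close> takes the default
      \<open>False\<close> outside \<open>V\<close>; any other function would have mass
      \<open>0\<close>.\<close>
    unfolding assignment_pmf_def using V assignment_outside[OF I] by (intro pmf_Pi') auto
  also have "\<dots> = (\<Prod>v\<in>V. \<alpha> (signed_literal (assignment I) v))"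
    using p \<alpha> by (intro prod.cong) (auto simp: signed_literal_def)
  also have "\<dots> = (\<Prod>l\<in>I. \<alpha> l)"
    using prod.interpretation_F[OF I] by metis
  finally show ?thesis .
qed

lemma prob_holds_eq_sum:
  assumes V: "finite V" and p: "\<And>v. v \<in> V \<Longrightarrow> p v \<in> {0..1}"
    and \<alpha>: "\<And>v. v \<in> V \<Longrightarrow> \<alpha> (Pos v) = p v \<and> \<alpha> (Neg v) = 1 - p v"
  shows "prob_holds V T p = (\<Sum>I\<in>models V T. \<Prod>l\<in>I. \<alpha> l)"
proof -
  let ?D = "assignment_pmf V p"
  have sub: "set_pmf ?D \<subseteq> assignment ` interpretations V"
    unfolding assignment_pmf_def assignment_image_interpretations
    using set_Pi_pmf_subset[OF V, of False "\<lambda>v. bernoulli_pmf (p v)"] by simp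
  \<comment> \<open>The event may contain assignments that are true outside \<open>V\<close>. They
    have mass zero, so the two sets are compared on the support only.\<close>
  have "{\<sigma>. theory_holds T \<sigma>} \<inter> set_pmf ?D = assignment ` models V T \<inter> set_pmf ?D"
    using sub by (auto simp: models_def)
  hence "prob_holds V T p = measure_pmf.prob ?D (assignment ` models V T)"
    unfolding prob_holds_def using measure_Int_set_pmf[of ?D] by metis
  also have "\<dots> = (\<Sum>\<sigma>\<in>assignment ` models V T. pmf ?D \<sigma>)"
    using V by (intro measure_measure_pmf_finite finite_imageI finite_models)
  also have "\<dots> = (\<Sum>I\<in>models V T. pmf ?D (assignment I))"
    using inj_on_subset[OF inj_on_assignment models_subset] by (subst sum.reindex) auto
  also have "\<dots> = (\<Sum>I\<in>models V T. \<Prod>l\<in>I. \<alpha> l)"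
    using models_subset by (intro sum.cong refl pmf_assignment V p \<alpha>) auto
  finally show ?thesis .
qed

lemma amc_mpe_value:
  assumes "finite V" "\<And>v. v \<in> V \<Longrightarrow> \<alpha> (Pos v) \<in> {0..1} \<and> \<alpha> (Neg v) = 1 - \<alpha> (Pos v)"
  shows "amc max_times_sr V T \<alpha> = mpe_value V T (\<lambda>v. \<alpha> (Pos v))"
proof -
  have "amc max_times_sr V T \<alpha> =
      (if models V T = {} then 0 else Max ((\<lambda>I. \<Prod>l\<in>I. \<alpha> l) ` models V T))"
    using assms by (intro amc_max_times) (auto simp: literals_def)
  moreover have "pmf (assignment_pmf V (\<lambda>v. \<alpha> (Pos v))) (assignment I) = (\<Prod>l\<in>I. \<alpha> l)"
    if "I \<in> models V T" for I
    using that assms models_subset by (intro pmf_assignment[OF assms(1)]) auto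
  ultimately show ?thesis by (simp add: mpe_value_def cong: image_cong)
qed

section \<open>Polynomials\<close>

lemma polys_zero: "0 \<in> polys V"
  and polys_one: "1 \<in> polys V"
  and polys_pvar: "v \<in> V \<Longrightarrow> pvar v \<in> polys V"
  and polys_pconst: "pconst c \<in> polys V"
  by (auto simp: polys_def pvar_def pconst_def)

lemma polys_add: "p \<in> polys V \<Longrightarrow> q \<in> polys V \<Longrightarrow> p + q \<in> polys V"
  using Poly_Mapping.keys_add[of p q] unfolding polys_def by blast

lemma polys_diff: "p \<in> polys V \<Longrightarrow> q \<in> polys V \<Longrightarrow> p - q \<in> polys V"
  using keys_diff[of p q] unfolding polys_def by blast

lemma polys_mult:
  assumes "p \<in> polys V" "q \<in> polys V"
  shows "p * q \<in> polys V"
  unfolding polys_def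
proof (intro CollectI ballI)
  fix m assume "m \<in> Poly_Mapping.keys (p * q)"
  then obtain a b where "m = a + b" "a \<in> Poly_Mapping.keys p" "b \<in> Poly_Mapping.keys q"
    using Poly_Mapping.keys_mult[of p q] by blast
  thus "Poly_Mapping.keys m \<subseteq> V"
    using assms Poly_Mapping.keys_add[of a b] unfolding polys_def by blast
qed

lemma polys_mono: "V \<subseteq> W \<Longrightarrow> polys V \<subseteq> polys W"
  unfolding polys_def by blast

lemma polys_sum: "(\<And>i. i \<in> A \<Longrightarrow> f i \<in> polys V) \<Longrightarrow> sum f A \<in> polys V"
  by (induction A rule: infinite_finite_induct) (auto intro: polys_zero polys_add)

lemma polys_prod: "(\<And>i. i \<in> A \<Longrightarrow> f i \<in> polys V) \<Longrightarrow> prod f A \<in> polys V"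
  by (induction A rule: infinite_finite_induct) (auto intro: polys_one polys_mult)

lemma commutative_semiring_poly: "commutative_semiring (poly_sr V)"
  by (rule commutative_semiringI)
    (auto simp: poly_sr_def algebra_simps intro: polys_zero polys_one polys_add polys_mult)

lemma amc_poly:
  assumes "finite V" "\<And>l. l \<in> literals V \<Longrightarrow> \<alpha> l \<in> polys V"
  shows "amc (poly_sr V) V T \<alpha> = (\<Sum>I\<in>models V T. \<Prod>l\<in>I. \<alpha> l)"
  by (rule amc_eqI[OF commutative_semiring_poly assms(1)]) (auto simp: poly_sr_def assms)

section \<open>Evaluation as a ring homomorphism\<close>

definition monomial_eval :: "('v \<Rightarrow> real) \<Rightarrow> ('v \<Rightarrow>\<^sub>0 nat) \<Rightarrow> real" where
  "monomial_eval \<theta> m =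
     (\<Prod>v\<in>Poly_Mapping.keys m. \<theta> v ^ Poly_Mapping.lookup m v)"

text \<open>Lets several monomials share one index set: a variable outside \<open>keys m\<close> has
  exponent \<open>0\<close> and contributes the factor \<open>1\<close>.\<close>

lemma monomial_eval_superset:
  assumes "finite K" "Poly_Mapping.keys m \<subseteq> K"
  shows "monomial_eval \<theta> m = (\<Prod>v\<in>K. \<theta> v ^ Poly_Mapping.lookup m v)"
  unfolding monomial_eval_def
  using assms by (intro prod.mono_neutral_left) (auto simp: in_keys_iff)

lemma monomial_eval_add: "monomial_eval \<theta> (m + n) = monomial_eval \<theta> m * monomial_eval \<theta> n"
proof -
  let ?K = "Poly_Mapping.keys m \<union> Poly_Mapping.keys n"
  have "monomial_eval \<theta> k = (\<Prod>v\<in>?K. \<theta> v ^ Poly_Mapping.lookup k v)" if "k \<in> {m, n, m + n}" for k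
    using that Poly_Mapping.keys_add[of m n] by (intro monomial_eval_superset) auto
  thus ?thesis by (simp add: lookup_add power_add prod.distrib)
qed

text \<open>Cancellation can make the keys of a sum smaller than the union of the keys; a common
  index set avoids tracking this, since the extra coefficients are \<open>0\<close>.\<close>

lemma peval_superset:
  assumes "finite K" "Poly_Mapping.keys q \<subseteq> K"
  shows "peval \<theta> q = (\<Sum>m\<in>K. Poly_Mapping.lookup q m * monomial_eval \<theta> m)"
  unfolding peval_def monomial_eval_def
  using assms by (intro sum.mono_neutral_left) (auto simp: in_keys_iff)

lemma peval_zero [simp]: "peval \<theta> 0 = 0"
  by (simp add: peval_def)

lemma peval_single: "peval \<theta> (Poly_Mapping.single m c) = c * monomial_eval \<theta> m"
  by (subst peval_superset[of "{m}"]) auto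

lemma peval_one [simp]: "peval \<theta> 1 = 1"
  using peval_single[of \<theta> 0 1] by (simp add: monomial_eval_def)

lemma peval_pconst [simp]: "peval \<theta> (pconst c) = c"
  by (simp add: pconst_def peval_single monomial_eval_def)

lemma peval_pvar [simp]: "peval \<theta> (pvar v) = \<theta> v"
  by (simp add: pvar_def peval_single monomial_eval_def)

lemma peval_add: "peval \<theta> (p + q) = peval \<theta> p + peval \<theta> q"
proof -
  let ?K = "Poly_Mapping.keys p \<union> Poly_Mapping.keys q"
  have "peval \<theta> r = (\<Sum>m\<in>?K. Poly_Mapping.lookup r m * monomial_eval \<theta> m)" if "r \<in> {p, q, p + q}" for r
    using that Poly_Mapping.keys_add[of p q] by (intro peval_superset) auto
  thus ?thesis by (simp add: lookup_add distrib_right sum.distrib)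
qed

lemma peval_diff: "peval \<theta> (p - q) = peval \<theta> p - peval \<theta> q"
  using peval_add[of \<theta> "p - q" q] by simp

text \<open>Updating a fresh key replaces a zero coefficient, which is the same as adding a single
  term; in this form the induction fits the additivity of \<open>peval\<close>.\<close>

lemma mpoly_induct [case_names zero add_single]:
  fixes p :: "'v mpoly"
  assumes "P 0" "\<And>q m c. P q \<Longrightarrow> P (q + Poly_Mapping.single m c)"
  shows "P p"
proof (induction p rule: update_induct)
  case (update f a b)
  have "Poly_Mapping.update a b f = f + Poly_Mapping.single a b"
    using update(1)
    by (intro poly_mapping_eqI) (auto simp: lookup_update lookup_add lookup_single in_keys_iff when_def)
  thus ?case using assms(2) update by metis
qed (fact assms(1))

text \<open>Both sides are additive in each factor, which leaves products of two single terms, where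
  exponents add.\<close>

lemma peval_mult: "peval \<theta> (p * q) = peval \<theta> p * peval \<theta> q"
proof (induction p rule: mpoly_induct)
  case (add_single p m c)
  have "peval \<theta> (Poly_Mapping.single m c * q) = peval \<theta> (Poly_Mapping.single m c) * peval \<theta> q"
  proof (induction q rule: mpoly_induct)
    case (add_single q n d)
    thus ?case
      by (simp add: distrib_left peval_add mult_single peval_single monomial_eval_add)
  qed simp
  thus ?case using add_single by (simp add: distrib_right peval_add)
qed simp

lemma peval_sum: "peval \<theta> (sum f A) = (\<Sum>i\<in>A. peval \<theta> (f i))"
  by (induction A rule: infinite_finite_induct) (auto simp: peval_add)

lemma peval_prod: "peval \<theta> (prod f A) = (\<Prod>i\<in>A. peval \<theta> (f i))"
  by (induction A rule: infinite_finite_induct) (auto simp: peval_mult)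

text \<open>Kronecker substitution: the exponents are the digits of a number in a sufficiently large
  base, which is why a single weighted sum recovers all of them.\<close>

lemma separating_weights:
  assumes "finite S" "finite M"
  shows "\<exists>w :: 'v \<Rightarrow> nat. \<forall>m\<in>M. \<forall>n\<in>M.
    (\<Sum>v\<in>S. w v * m v) = (\<Sum>v\<in>S. w v * n v) \<longrightarrow> (\<forall>v\<in>S. m v = n v)"
  using assms(1)
proof (induction S rule: finite_induct)
  case (insert x S)
  then obtain w where w: "\<And>m n. m \<in> M \<Longrightarrow> n \<in> M \<Longrightarrow>
      (\<Sum>v\<in>S. w v * m v) = (\<Sum>v\<in>S. w v * n v) \<Longrightarrow> \<forall>v\<in>S. m v = n v"
    by blast
  \<comment> \<open>The base: \<open>Suc\<close> makes it a strict bound on all values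
    \<open>m x\<close>, so \<open>m x\<close> is a remainder modulo \<open>N\<close> and the
    weighted sum over \<open>S\<close> is the quotient.\<close>
  define N where "N = Suc (\<Sum>m\<in>M. m x)"
  have N: "m x < N" if "m \<in> M" for m
    unfolding N_def less_Suc_eq_le using that assms(2) by (intro member_le_sum) auto
  \<comment> \<open>The new variable becomes the lowest digit; all earlier digits move up by one
    place.\<close>
  define w' where "w' v = (if v = x then 1 else N * w v)" for v
  have w': "(\<Sum>v\<in>insert x S. w' v * m v) = N * (\<Sum>v\<in>S. w v * m v) + m x" for m
  proof -
    have "(\<Sum>v\<in>S. w' v * m v) = N * (\<Sum>v\<in>S. w v * m v)"
      unfolding sum_distrib_left using insert.hyps by (intro sum.cong) (auto simp: w'_def)
    thus ?thesis using insert.hyps by (simp add: w'_def)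
  qed
  have "\<forall>v\<in>insert x S. m v = n v"
    if "m \<in> M" "n \<in> M" "(\<Sum>v\<in>insert x S. w' v * m v) = (\<Sum>v\<in>insert x S. w' v * n v)" for m n
  proof -
    have eq: "N * (\<Sum>v\<in>S. w v * m v) + m x = N * (\<Sum>v\<in>S. w v * n v) + n x"
      using that(3) by (simp only: w')
    have "m x = n x"
      using arg_cong[OF eq, of "\<lambda>k. k mod N"] N that by simp
    moreover have "(\<Sum>v\<in>S. w v * m v) = (\<Sum>v\<in>S. w v * n v)"
      using eq \<open>m x = n x\<close> N[OF that(1)] by simp
    ultimately show ?thesis using w that by blast
  qed
  thus ?case by blast
qed simp

text \<open>Substituting \<open>x ^ w v\<close> for each \<open>v\<close> gives a univariate
  polynomial \<open>P\<close> in which different monomials of \<open>q\<close> get different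
  exponents, so nothing cancels. For \<open>x\<close> in the unit interval the substituted values
  stay there as well, hence \<open>P\<close> has infinitely many roots.\<close>

lemma peval_eq_0_imp_eq_0:
  assumes S: "finite S" and q: "q \<in> polys S"
    and zero: "\<And>\<theta>. (\<And>v. v \<in> S \<Longrightarrow> \<theta> v \<in> {0..1}) \<Longrightarrow> peval \<theta> q = 0"
  shows "q = 0"
proof (rule ccontr)
  assume "q \<noteq> 0"
  let ?K = "Poly_Mapping.keys q" and ?c = "Poly_Mapping.lookup q"
  obtain w where w: "\<And>m n. m \<in> ?K \<Longrightarrow> n \<in> ?K \<Longrightarrow>
      (\<Sum>v\<in>S. w v * Poly_Mapping.lookup m v) = (\<Sum>v\<in>S. w v * Poly_Mapping.lookup n v) \<Longrightarrow>
      \<forall>v\<in>S. Poly_Mapping.lookup m v = Poly_Mapping.lookup n v"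
    using separating_weights[OF S, of "Poly_Mapping.lookup ` ?K"] by auto
  define e where "e m = (\<Sum>v\<in>S. w v * Poly_Mapping.lookup m v)" for m :: "'a \<Rightarrow>\<^sub>0 nat"
  have supp: "Poly_Mapping.keys m \<subseteq> S" if "m \<in> ?K" for m
    using that q by (auto simp: polys_def)
  have e: "m = n" if "m \<in> ?K" "n \<in> ?K" "e m = e n" for m n
  proof (rule poly_mapping_eqI)
    fix v
    show "Poly_Mapping.lookup m v = Poly_Mapping.lookup n v"
    proof (cases "v \<in> S")
      case False
      hence "v \<notin> Poly_Mapping.keys m" "v \<notin> Poly_Mapping.keys n" using that supp by blast+
      thus ?thesis by (simp add: in_keys_iff)
    qed (use w[of m n] that in \<open>auto simp: e_def\<close>)
  qed
  define P :: "real poly" where "P = (\<Sum>m\<in>?K. monom (?c m) (e m))"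
  have "poly P x = 0" if "x \<in> {0..1}" for x
  proof -
    have "peval (\<lambda>v. x ^ w v) q = 0"
      using that by (intro zero) (auto intro: power_le_one)
    moreover have "monomial_eval (\<lambda>v. x ^ w v) m = x ^ e m" if "m \<in> ?K" for m
      using monomial_eval_superset[OF S supp[OF that]]
      by (simp add: e_def power_sum power_mult)
    ultimately have "(\<Sum>m\<in>?K. ?c m * x ^ e m) = 0"
      by (simp add: peval_superset[of ?K])
    thus ?thesis by (simp add: P_def poly_sum poly_monom)
  qed
  hence "{0..1} \<subseteq> {x. poly P x = 0}" by (intro subsetI CollectI)
  moreover have "infinite {0..1::real}" by (rule infinite_Icc) simp
  ultimately have "infinite {x. poly P x = 0}" by (rule infinite_super)
  hence "P = 0" using poly_roots_finite[of P] by metis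
  obtain m where m: "m \<in> ?K" using \<open>q \<noteq> 0\<close> keys_eq_empty[of q] by blast
  \<comment> \<open>Injectivity of \<open>e\<close> on the monomials of \<open>q\<close>: only
    \<open>m\<close> itself contributes at the exponent \<open>e m\<close>.\<close>
  have "Polynomial.coeff P (e m) = (\<Sum>n\<in>?K. if n = m then ?c n else 0)"
    unfolding P_def coeff_sum using e m by (intro sum.cong) (auto simp: coeff_monom)
  hence "?c m = 0" using \<open>P = 0\<close> m by simp
  thus False using m by (simp add: in_keys_iff)
qed

lemma is_prob_poly_unique:
  assumes "finite S" "is_prob_poly V T S p q" "is_prob_poly V T S p q'"
  shows "q = q'"
proof -
  have "q - q' = 0"
    using assms by (intro peval_eq_0_imp_eq_0[of S]) (auto simp: is_prob_poly_def polys_diff peval_diff)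
  thus ?thesis by simp
qed

lemma peval_models_sum:
  "peval \<theta> (\<Sum>I\<in>models V T. \<Prod>l\<in>I. \<alpha> l) = (\<Sum>I\<in>models V T. \<Prod>l\<in>I. peval \<theta> (\<alpha> l))"
  by (simp add: peval_sum peval_prod)

text \<open>Evaluation at \<theta> turns the labels into the numbers \<open>\<theta> v\<close> or
  \<open>p v\<close> and their complements, and the sum of products into the probability for these.
  All labels already lie in the smaller ring \<open>polys S\<close>, hence so does the
  result.\<close>

lemma is_prob_poly_amc_poly:
  assumes V: "finite V" and S: "S \<subseteq> V"
    and pos: "\<And>v. v \<in> S \<Longrightarrow> \<alpha> (Pos v) = pvar v"
    and const: "\<And>v. v \<in> V - S \<Longrightarrow> p v \<in> {0..1} \<and> \<alpha> (Pos v) = pconst (p v)"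
    and neg: "\<And>v. v \<in> V \<Longrightarrow> \<alpha> (Neg v) = 1 - \<alpha> (Pos v)"
  shows "is_prob_poly V T S p (amc (poly_sr V) V T \<alpha>)"
proof -
  have pos_S: "\<alpha> (Pos v) \<in> polys S" if "v \<in> V" for v
    using that pos const by (cases "v \<in> S") (auto intro: polys_pvar polys_pconst)
  have in_S: "\<alpha> l \<in> polys S" if "l \<in> literals V" for l
    using that by (auto simp: literals_def neg intro!: polys_diff polys_one pos_S)
  have amc: "amc (poly_sr V) V T \<alpha> = (\<Sum>I\<in>models V T. \<Prod>l\<in>I. \<alpha> l)"
    using in_S polys_mono[OF S] by (intro amc_poly V) blast
  show ?thesis
    unfolding is_prob_poly_def amc
  proof (intro conjI allI impI)
    show "(\<Sum>I\<in>models V T. \<Prod>l\<in>I. \<alpha> l) \<in> polys S"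
      by (intro polys_sum polys_prod in_S) (auto intro: models_literals)
    show "peval \<theta> (\<Sum>I\<in>models V T. \<Prod>l\<in>I. \<alpha> l) = prob_holds V T (\<lambda>v. if v \<in> S then \<theta> v else p v)"
      if "\<forall>v\<in>S. \<theta> v \<in> {0..1}" for \<theta>
      unfolding peval_models_sum using that pos const neg
      by (intro prob_holds_eq_sum[symmetric] V) (auto simp: peval_diff)
  qed
qed

section \<open>Gradients\<close>

lemma differentiable_prod:
  fixes h :: "'i \<Rightarrow> real \<Rightarrow> real"
  assumes "\<And>i. i \<in> A \<Longrightarrow> h i differentiable at x"
  shows "(\<lambda>y. \<Prod>i\<in>A. h i y) differentiable at x"
  using assms by (induction A rule: infinite_finite_induct) auto

text \<open>Elements of \<open>grad_sr\<close> are the values and derivatives of functions at a point, on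
  which the semiring operations are the sum and the product rule.\<close>

lemma amc_grad:
  assumes V: "finite V"
    and h: "\<And>l. l \<in> literals V \<Longrightarrow> h l x \<ge> 0"
      "\<And>l. l \<in> literals V \<Longrightarrow> (h l has_real_derivative h' l) (at x)"
    and \<alpha>: "\<And>l. l \<in> literals V \<Longrightarrow> \<alpha> l = (h l x, h' l)"
  shows "amc grad_sr V T \<alpha> =
    ((\<Sum>I\<in>models V T. \<Prod>l\<in>I. h l x), deriv (\<lambda>y. \<Sum>I\<in>models V T. \<Prod>l\<in>I. h l y) x)"
proof (rule amc_eqI[where P = "\<lambda>I. ((\<Prod>l\<in>I. h l x), deriv (\<lambda>y. \<Prod>l\<in>I. h l y) x)"
      and S = "\<lambda>M. ((\<Sum>I\<in>M. \<Prod>l\<in>I. h l x), deriv (\<lambda>y. \<Sum>I\<in>M. \<Prod>l\<in>I. h l y) x)",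
      OF commutative_semiring_grad V])
  \<comment> \<open>\<open>deriv\<close> is total, so existence of the derivative is secured
    separately before the product and sum rules are applied.\<close>
  have prod: "((\<lambda>y. \<Prod>l\<in>I. h l y) has_real_derivative deriv (\<lambda>y. \<Prod>l\<in>I. h l y) x) (at x)"
    if "I \<subseteq> literals V" for I
    unfolding DERIV_deriv_iff_real_differentiable
    using that h(2) real_differentiable_def by (intro differentiable_prod) blast
  have sum: "((\<lambda>y. \<Sum>I\<in>M. \<Prod>l\<in>I. h l y) has_real_derivative
      deriv (\<lambda>y. \<Sum>I\<in>M. \<Prod>l\<in>I. h l y) x) (at x)"
    if "finite M" "M \<subseteq> Pow (literals V)" for M
  proof -
    have "(\<lambda>y. \<Prod>l\<in>I. h l y) differentiable at x" if "I \<in> M" for I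
      using prod[of I] that \<open>M \<subseteq> Pow (literals V)\<close> real_differentiable_def by blast
    thus ?thesis
      unfolding DERIV_deriv_iff_real_differentiable using that(1) by (intro differentiable_sum) auto
  qed
  show "((\<Prod>l\<in>insert l J. h l x), deriv (\<lambda>y. \<Prod>l\<in>insert l J. h l y) x) =
      \<alpha> l \<otimes>\<^bsub>grad_sr\<^esub> ((\<Prod>l\<in>J. h l x), deriv (\<lambda>y. \<Prod>l\<in>J. h l y) x)"
    if "l \<in> literals V" "J \<subseteq> literals V" "finite J" "l \<notin> J" for l J
  proof -
    have "deriv (\<lambda>y. \<Prod>l\<in>insert l J. h l y) x =
        h l x * deriv (\<lambda>y. \<Prod>l\<in>J. h l y) x + h' l * (\<Prod>l\<in>J. h l x)"
      using DERIV_mult'[OF h(2)[OF that(1)] prod[OF that(2)]] that by (intro DERIV_imp_deriv) simp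
    thus ?thesis using that by (simp add: \<alpha> grad_sr_def)
  qed
  show "((\<Sum>I\<in>insert I M. \<Prod>l\<in>I. h l x), deriv (\<lambda>y. \<Sum>I\<in>insert I M. \<Prod>l\<in>I. h l y) x) =
      ((\<Prod>l\<in>I. h l x), deriv (\<lambda>y. \<Prod>l\<in>I. h l y) x) \<oplus>\<^bsub>grad_sr\<^esub>
      ((\<Sum>I\<in>M. \<Prod>l\<in>I. h l x), deriv (\<lambda>y. \<Sum>I\<in>M. \<Prod>l\<in>I. h l y) x)"
    if "I \<subseteq> literals V" "finite M" "I \<notin> M" "M \<subseteq> Pow (literals V)" for I M
  proof -
    have "deriv (\<lambda>y. \<Sum>I\<in>insert I M. \<Prod>l\<in>I. h l y) x =
        deriv (\<lambda>y. \<Prod>l\<in>I. h l y) x + deriv (\<lambda>y. \<Sum>I\<in>M. \<Prod>l\<in>I. h l y) x"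
      using DERIV_add[OF prod[OF that(1)] sum[OF that(2,4)]] that by (intro DERIV_imp_deriv) simp
    thus ?thesis using that by (simp add: grad_sr_def)
  qed
qed (auto simp: grad_sr_def \<alpha> h)

text \<open>Making all variables symbolic gives the probability polynomial \<open>Q\<close>. Along
  the line \<open>p(k := x)\<close> the literals become functions \<open>h l\<close> with slope
  \<open>1\<close> for \<open>Pos k\<close>, \<open>- 1\<close> for \<open>Neg k\<close> and
  \<open>0\<close> otherwise, which are the second components of the labels.\<close>

lemma is_prob_grad_amc_grad:
  assumes V: "finite V" and p: "\<And>v. v \<in> V \<Longrightarrow> p v \<in> {0..1}"
    and k: "\<alpha> (Pos k) = (p k, 1)" "\<alpha> (Neg k) = (1 - p k, - 1)"
    and others: "\<And>v. v \<in> V - {k} \<Longrightarrow> \<alpha> (Pos v) = (p v, 0) \<and> \<alpha> (Neg v) = (1 - p v, 0)"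
  shows "is_prob_grad V T p k (amc grad_sr V T \<alpha>)"
proof -
  define \<beta> :: "'a literal \<Rightarrow> 'a mpoly" where
    "\<beta> l = (case l of Pos v \<Rightarrow> pvar v | Neg v \<Rightarrow> 1 - pvar v)" for l
  define Q where "Q = amc (poly_sr V) V T \<beta>"
  \<comment> \<open>Existence and uniqueness in one equivalence; as a rewrite rule it settles both
    quantifiers over polynomials in \<open>is_prob_grad\<close>.\<close>
  have Q: "is_prob_poly V T V p q \<longleftrightarrow> q = Q" for q
    using is_prob_poly_amc_poly[OF V, of V \<beta> p T] is_prob_poly_unique[OF V]
    unfolding Q_def by (auto simp: \<beta>_def)
  define h where "h l x = peval (p(k := x)) (\<beta> l)" for l x
  have peval_Q: "peval (p(k := x)) Q = (\<Sum>I\<in>models V T. \<Prod>l\<in>I. h l x)" for x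
    unfolding Q_def h_def
    by (subst amc_poly[OF V])
      (auto simp: \<beta>_def literals_def peval_models_sum intro!: polys_diff polys_one polys_pvar)
  \<comment> \<open>Each \<open>h l\<close> is affine in \<open>x\<close>, so the slope is the same
    at every point. Nonnegativity at \<open>p k\<close> places the label in the carrier.\<close>
  have lit: "h l (p k) \<ge> 0 \<and> (h l has_real_derivative snd (\<alpha> l)) (at x) \<and>
      \<alpha> l = (h l (p k), snd (\<alpha> l))" if l: "l \<in> literals V" for l x
  proof -
    obtain v where v: "v \<in> V" "l = Pos v \<or> l = Neg v"
      using l unfolding literals_def by blast
    have "h (Pos v) = (\<lambda>x. (p(k := x)) v)" "h (Neg v) = (\<lambda>x. 1 - (p(k := x)) v)"
      by (simp_all add: fun_eq_iff h_def \<beta>_def peval_diff)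
    thus ?thesis
      using v p[of v] k others[of v]
      by (cases "v = k") (auto intro!: derivative_eq_intros)
  qed
  have amc: "amc grad_sr V T \<alpha> = (peval p Q, deriv (\<lambda>x. peval (p(k := x)) Q) (p k))"
    using amc_grad[OF V, of h "p k" "\<lambda>l. snd (\<alpha> l)" \<alpha> T] lit peval_Q[of "p k"]
    by (simp add: peval_Q)
  have "h l differentiable at (p k)" if "l \<in> literals V" for l
    using lit[OF that] real_differentiable_def by blast
  hence "(\<lambda>x. peval (p(k := x)) Q) differentiable at (p k)"
    unfolding peval_Q
    by (intro differentiable_sum differentiable_prod finite_models V ballI) (use models_literals in blast)
  thus ?thesis
    unfolding is_prob_grad_def Q amc
    by (simp add: DERIV_deriv_iff_real_differentiable)
qed

section \<open>Paths\<close>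

lemma holds_FConj: "holds \<sigma> (FConj \<phi>s) \<longleftrightarrow> (\<forall>\<phi>\<in>set \<phi>s. holds \<sigma> \<phi>)"
  unfolding FConj_def by (induction \<phi>s) auto

lemma holds_FDisj: "holds \<sigma> (FDisj \<phi>s) \<longleftrightarrow> (\<exists>\<phi>\<in>set \<phi>s. holds \<sigma> \<phi>)"
  unfolding FDisj_def by (induction \<phi>s) auto

lemma path_theory_holds:
  assumes "is_path_theory G s t T"
  shows "theory_holds T \<sigma> \<longleftrightarrow> (\<exists>p. pre_digraph.apath G s p t \<and> (\<forall>e\<in>set p. \<sigma> e))"
proof -
  obtain ps where "set ps = {p. pre_digraph.apath G s p t}"
    "T = {FDisj (map (\<lambda>p. FConj (map FVar p)) ps)}"
    using assms unfolding is_path_theory_def by blast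
  thus ?thesis by (simp add: theory_holds_def holds_FDisj holds_FConj)
qed

lemma sum_interpretation_pos:
  fixes \<alpha> :: "'v literal \<Rightarrow> enat"
  assumes V: "finite V" and I: "I \<in> interpretations V" and neg: "\<And>v. v \<in> V \<Longrightarrow> \<alpha> (Neg v) = 0"
  shows "(\<Sum>l\<in>I. \<alpha> l) = (\<Sum>v\<in>{v. assignment I v}. \<alpha> (Pos v))"
proof -
  have "(\<Sum>l\<in>I. \<alpha> l) = (\<Sum>v\<in>V. \<alpha> (signed_literal (assignment I) v))"
    using sum.interpretation_F[OF I] by metis
  also have "\<dots> = (\<Sum>v\<in>V. if assignment I v then \<alpha> (Pos v) else 0)"
    by (intro sum.cong) (auto simp: signed_literal_def neg)
  also have "\<dots> = (\<Sum>v\<in>V \<inter> {v. assignment I v}. \<alpha> (Pos v))"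
    using V by (simp add: sum.If_cases)
  also have "V \<inter> {v. assignment I v} = {v. assignment I v}"
    using assignment_outside[OF I] by blast
  finally show ?thesis .
qed

lemma Inf_interpretation_pos:
  fixes \<alpha> :: "'v literal \<Rightarrow> enat"
  assumes I: "I \<in> interpretations V" and neg: "\<And>v. v \<in> V \<Longrightarrow> \<alpha> (Neg v) = \<infinity>"
  shows "(INF l\<in>I. \<alpha> l) = (INF v\<in>{v. assignment I v}. \<alpha> (Pos v))"
proof (rule antisym)
  show "(INF l\<in>I. \<alpha> l) \<le> (INF v\<in>{v. assignment I v}. \<alpha> (Pos v))"
    by (rule INF_mono) (auto simp: assignment_def)
  show "(INF v\<in>{v. assignment I v}. \<alpha> (Pos v)) \<le> (INF l\<in>I. \<alpha> l)"
  proof (rule INF_greatest)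
    fix l assume l: "l \<in> I"
    show "(INF v\<in>{v. assignment I v}. \<alpha> (Pos v)) \<le> \<alpha> l"
    proof (cases l)
      case (Pos v)
      thus ?thesis using l by (auto simp: assignment_def intro!: INF_lower2[of v])
    next
      case (Neg v)
      hence "\<alpha> l = \<infinity>" using l I neg by (auto simp: interpretations_def literals_def)
      thus ?thesis by simp
    qed
  qed
qed

text \<open>A walk may repeat edges; counting each of them once cannot raise the cost, as
  \<open>enat\<close> has no negative elements.\<close>

lemma sum_set_le_sum_list:
  fixes w :: "'v \<Rightarrow> enat"
  shows "sum w (set xs) \<le> sum_list (map w xs)"
  by (induction xs) (auto simp: sum.insert_if intro: add_left_mono order_trans[OF _ le_iff_add[THEN iffD2]])

text \<open>A path without repeated vertices has no repeated edges.\<close>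

lemma (in wf_digraph) apath_sum_list:
  "apath u p v \<Longrightarrow> sum_list (map w p) = sum w (set p)"
  unfolding apath_def using distinct_verts_imp_distinct sum_list_distinct_conv_sum_set by blast

locale path_problem = fin_digraph G for G :: "('n, 'v) pre_digraph" +
  fixes s t :: 'n and T :: "'v form set"
  assumes s_neq_t: "s \<noteq> t" and path_theory: "is_path_theory G s t T"
begin

lemma model_contains_apath:
  assumes "I \<in> models (arcs G) T"
  obtains p where "apath s p t" "set p \<subseteq> {v. assignment I v}"
  using assms path_theory_holds[OF path_theory] by (auto simp: models_def)

text \<open>Making exactly the edges of \<open>p\<close> true gives a model with the value of
  \<open>p\<close>. With \<open>model_contains_apath\<close>, models and simple paths bound each
  other's values in both directions.\<close>

lemma apath_model:
  assumes "apath s p t"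
  obtains I where "I \<in> models (arcs G) T" "{v. assignment I v} = set p"
proof
  let ?I = "signed_literal (\<lambda>v. v \<in> set p) ` arcs G"
  have "set p \<subseteq> arcs G" using assms by (auto simp: apath_def awalk_def)
  thus true: "{v. assignment ?I v} = set p" by (auto simp: assignment_signed_literal)
  have "theory_holds T (assignment ?I)"
    using path_theory_holds[OF path_theory] assms true by blast
  thus "?I \<in> models (arcs G) T"
    by (simp add: models_def signed_literal_image_in_interpretations)
qed

text \<open>Keeps \<open>Min\<close> over the edges of a path away from the empty set.\<close>

lemma apath_nonempty: "apath s p t \<Longrightarrow> p \<noteq> []"
  using s_neq_t by (auto simp: apath_Nil_iff)

text \<open>A walk and its cycle-free reduction are compared through their edge sets: the reduction
  uses a subset of the edges, each once, while the walk pays for each of its edges at least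
  once.\<close>

lemma shortest_awalk: "shortest {p. awalk s p t} w = shortest {p. apath s p t} w"
proof (rule antisym)
  show "shortest {p. awalk s p t} w \<le> shortest {p. apath s p t} w"
    unfolding shortest_def by (rule INF_superset_mono) (auto simp: apath_def)
  show "shortest {p. apath s p t} w \<le> shortest {p. awalk s p t} w"
    unfolding shortest_def
  proof (rule INF_mono)
    fix p assume "p \<in> {p. awalk s p t}"
    hence p: "awalk s p t" by simp
    have "sum_list (map w (awalk_to_apath p)) = sum w (set (awalk_to_apath p))"
      by (rule apath_sum_list[OF apath_awalk_to_apath[OF p]])
    also have "\<dots> \<le> sum w (set p)"
      using awalk_to_apath_subset[OF p] by (intro sum_mono2) auto
    also have "\<dots> \<le> sum_list (map w p)" by (rule sum_set_le_sum_list)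
    finally show "\<exists>q\<in>{p. apath s p t}. sum_list (map w q) \<le> sum_list (map w p)"
      using apath_awalk_to_apath[OF p] by blast
  qed
qed

lemma widest_awalk: "widest {p. awalk s p t} w = widest {p. apath s p t} w"
proof (rule antisym)
  show "widest {p. apath s p t} w \<le> widest {p. awalk s p t} w"
    unfolding widest_def by (rule SUP_subset_mono) (auto simp: apath_def)
  show "widest {p. awalk s p t} w \<le> widest {p. apath s p t} w"
    unfolding widest_def
  proof (rule SUP_mono)
    fix p assume "p \<in> {p. awalk s p t}"
    hence p: "awalk s p t" by simp
    have "Min (w ` set p) \<le> Min (w ` set (awalk_to_apath p))"
      using awalk_to_apath_subset[OF p] apath_nonempty[OF apath_awalk_to_apath[OF p]]
      by (intro Min_antimono) auto
    thus "\<exists>q\<in>{p. apath s p t}. Min (w ` set p) \<le> Min (w ` set q)"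
      using apath_awalk_to_apath[OF p] by blast
  qed
qed

lemma amc_shortest:
  assumes "\<And>v. v \<in> arcs G \<Longrightarrow> \<alpha> (Neg v) = 0"
  shows "amc min_plus_sr (arcs G) T \<alpha> = shortest {p. apath s p t} (\<lambda>v. \<alpha> (Pos v))"
proof -
  let ?w = "\<lambda>v. \<alpha> (Pos v)"
  have sum: "(\<Sum>l\<in>I. \<alpha> l) = sum ?w {v. assignment I v}" if "I \<in> models (arcs G) T" for I
    by (rule sum_interpretation_pos[of "arcs G"]) (use that models_subset assms in auto)
  have "(INF I\<in>models (arcs G) T. \<Sum>l\<in>I. \<alpha> l) = (INF p\<in>{p. apath s p t}. sum_list (map ?w p))"
  proof (rule antisym; rule INF_mono)
    fix p assume "p \<in> {p. apath s p t}"
    hence p: "apath s p t" by simp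
    then obtain I where "I \<in> models (arcs G) T" "{v. assignment I v} = set p"
      by (rule apath_model)
    thus "\<exists>I\<in>models (arcs G) T. (\<Sum>l\<in>I. \<alpha> l) \<le> sum_list (map ?w p)"
      using apath_sum_list[OF p, where w = ?w] sum by (intro bexI[of _ I]) simp_all
  next
    fix I assume I: "I \<in> models (arcs G) T"
    then obtain p where p: "apath s p t" "set p \<subseteq> {v. assignment I v}"
      by (rule model_contains_apath)
    \<comment> \<open>Secures finiteness: \<open>sum\<close> over an infinite set would default to
      \<open>0\<close> and monotonicity would break.\<close>
    have "{v. assignment I v} \<subseteq> arcs G"
      using assignment_outside[of I "arcs G"] I by (auto simp: models_def)
    hence "sum ?w (set p) \<le> sum ?w {v. assignment I v}"
      using p(2) finite_subset[OF _ finite_arcs] by (intro sum_mono2) auto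
    thus "\<exists>p\<in>{p. apath s p t}. sum_list (map ?w p) \<le> (\<Sum>l\<in>I. \<alpha> l)"
      using p(1) apath_sum_list[OF p(1), where w = ?w] sum[OF I] by (intro bexI[of _ p]) simp_all
  qed
  thus ?thesis by (simp add: amc_min_plus shortest_def)
qed

lemma amc_widest:
  assumes "\<And>v. v \<in> arcs G \<Longrightarrow> \<alpha> (Neg v) = \<infinity>"
  shows "amc max_min_sr (arcs G) T \<alpha> = widest {p. apath s p t} (\<lambda>v. \<alpha> (Pos v))"
proof -
  let ?w = "\<lambda>v. \<alpha> (Pos v)"
  have Inf: "(INF l\<in>I. \<alpha> l) = (INF v\<in>{v. assignment I v}. ?w v)" if "I \<in> models (arcs G) T" for I
    by (rule Inf_interpretation_pos[of _ "arcs G"]) (use that models_subset assms in auto)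
  have Min: "Min (?w ` set p) = (INF v\<in>set p. ?w v)" if "apath s p t" for p
    using apath_nonempty[OF that] by (intro Min_Inf) auto
  have "(SUP I\<in>models (arcs G) T. INF l\<in>I. \<alpha> l) = (SUP p\<in>{p. apath s p t}. Min (?w ` set p))"
  proof (rule antisym; rule SUP_mono)
    fix p assume "p \<in> {p. apath s p t}"
    hence p: "apath s p t" by simp
    then obtain I where "I \<in> models (arcs G) T" "{v. assignment I v} = set p"
      by (rule apath_model)
    thus "\<exists>I\<in>models (arcs G) T. Min (?w ` set p) \<le> (INF l\<in>I. \<alpha> l)"
      using Min[OF p] Inf by (intro bexI[of _ I]) simp_all
  next
    fix I assume I: "I \<in> models (arcs G) T"
    then obtain p where p: "apath s p t" "set p \<subseteq> {v. assignment I v}"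
      by (rule model_contains_apath)
    have "(INF l\<in>I. \<alpha> l) \<le> Min (?w ` set p)"
      unfolding Inf[OF I] Min[OF p(1)] using p(2) by (rule INF_superset_mono) simp
    thus "\<exists>p\<in>{p. apath s p t}. (INF l\<in>I. \<alpha> l) \<le> Min (?w ` set p)"
      using p(1) by blast
  qed
  thus ?thesis by (simp add: amc_max_min widest_def)
qed

end

section \<open>Ordered binary decision diagrams\<close>

fun literal_holds :: "('v \<Rightarrow> bool) \<Rightarrow> 'v literal \<Rightarrow> bool" where
  "literal_holds \<sigma> (Pos v) \<longleftrightarrow> \<sigma> v"
| "literal_holds \<sigma> (Neg v) \<longleftrightarrow> \<not> \<sigma> v"

lemma literal_holds_cong:
  "l \<in> literals V \<Longrightarrow> \<forall>v\<in>V. \<sigma> v = \<tau> v \<Longrightarrow> literal_holds \<sigma> l = literal_holds \<tau> l"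
  by (auto simp: literals_def)

text \<open>The conjunction of the literals in \<open>I\<close> is a minterm: on \<open>V\<close> it
  is satisfied by a single assignment.\<close>

lemma interpretation_holds_iff:
  assumes "I \<in> interpretations V"
  shows "(\<forall>l\<in>I. literal_holds \<sigma> l) \<longleftrightarrow> (\<forall>v\<in>V. assignment I v = \<sigma> v)"
proof -
  have "literal_holds \<sigma> (signed_literal \<tau> v) \<longleftrightarrow> \<tau> v = \<sigma> v" for \<tau> v
    by (simp add: signed_literal_def)
  hence "(\<forall>l\<in>signed_literal (assignment I) ` V. literal_holds \<sigma> l) \<longleftrightarrow>
      (\<forall>v\<in>V. assignment I v = \<sigma> v)"
    by simp
  thus ?thesis unfolding interpretation_eq_image[OF assms, symmetric] .
qed

text \<open>This is the full disjunctive normal form of \<open>T\<close>. The model that witnesses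
  it is the restriction of \<sigma> to \<open>V\<close>, on which alone the truth of
  \<open>T\<close> depends.\<close>

lemma some_model_holds_iff:
  assumes "theory_over V T"
  shows "(\<exists>I\<in>models V T. \<forall>l\<in>I. literal_holds \<sigma> l) \<longleftrightarrow> theory_holds T \<sigma>"
proof
  assume "\<exists>I\<in>models V T. \<forall>l\<in>I. literal_holds \<sigma> l"
  then obtain I where "I \<in> models V T" "\<forall>v\<in>V. assignment I v = \<sigma> v"
    using interpretation_holds_iff[of _ V \<sigma>] by (auto simp: models_def)
  thus "theory_holds T \<sigma>"
    using theory_holds_cong[OF assms, of "assignment I" \<sigma>] by (simp add: models_def)
next
  assume T: "theory_holds T \<sigma>"
  let ?I = "signed_literal \<sigma> ` V"
  have agree: "\<forall>v\<in>V. assignment ?I v = \<sigma> v" by (simp add: assignment_signed_literal)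
  hence "?I \<in> models V T"
    using T theory_holds_cong[OF assms, of "assignment ?I" \<sigma>]
    by (simp add: models_def signed_literal_image_in_interpretations)
  moreover have "\<forall>l\<in>?I. literal_holds \<sigma> l" by (auto simp: signed_literal_def)
  ultimately show "\<exists>I\<in>models V T. \<forall>l\<in>I. literal_holds \<sigma> l" by blast
qed

context
  fixes V :: "'v set" and r :: "('v \<times> 'v) set"
  assumes V: "finite V" and r: "strict_linear_order_on V r"
begin

text \<open>Canonicity makes the definite description proper for every function that depends only on
  \<open>V\<close>.\<close>

lemma obdd_spec:
  assumes "\<And>\<sigma> \<tau>. \<forall>v\<in>V. \<sigma> v = \<tau> v \<Longrightarrow> f \<sigma> = f \<tau>"
  shows "obdd r V f \<in> obdds r V" "bdd_eval (obdd r V f) = f"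
  using theI'[OF obdd_canonical[OF V r, of f]] assms unfolding obdd_def by blast+

lemma bdd_eval_obdds_cong:
  "d \<in> obdds r V \<Longrightarrow> \<forall>v\<in>V. \<sigma> v = \<tau> v \<Longrightarrow> bdd_eval d \<sigma> = bdd_eval d \<tau>"
  by (rule bdd_eval_cong) (auto simp: obdds_def)

lemma obdd_or_spec:
  assumes "d \<in> obdds r V" "e \<in> obdds r V"
  shows "obdd_or r V d e \<in> obdds r V"
    "bdd_eval (obdd_or r V d e) = (\<lambda>\<sigma>. bdd_eval d \<sigma> \<or> bdd_eval e \<sigma>)"
  unfolding obdd_or_def
  by (rule obdd_spec; use bdd_eval_obdds_cong[OF assms(1)] bdd_eval_obdds_cong[OF assms(2)] in metis)+

lemma obdd_and_spec:
  assumes "d \<in> obdds r V" "e \<in> obdds r V"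
  shows "obdd_and r V d e \<in> obdds r V"
    "bdd_eval (obdd_and r V d e) = (\<lambda>\<sigma>. bdd_eval d \<sigma> \<and> bdd_eval e \<sigma>)"
  unfolding obdd_and_def
  by (rule obdd_spec; use bdd_eval_obdds_cong[OF assms(1)] bdd_eval_obdds_cong[OF assms(2)] in metis)+

lemma obdd_const_spec:
  "obdd r V (\<lambda>_. b) \<in> obdds r V" "bdd_eval (obdd r V (\<lambda>_. b)) = (\<lambda>_. b)"
  by (rule obdd_spec; simp)+

lemma commutative_semiring_obdd: "commutative_semiring (obdd_sr r V)"
  by (rule commutative_semiringI)
    (auto simp: obdd_sr_def obdd_or_spec obdd_and_spec obdd_const_spec intro!: obdd_unique[OF r])

lemma amc_obdd:
  assumes T: "theory_over V T"
    and \<alpha>: "\<And>l. l \<in> literals V \<Longrightarrow> \<alpha> l = obdd r V (\<lambda>\<sigma>. literal_holds \<sigma> l)"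
  shows "amc (obdd_sr r V) V T \<alpha> = obdd r V (theory_holds T)"
proof -
  let ?P = "\<lambda>I. obdd r V (\<lambda>\<sigma>. \<forall>l\<in>I. literal_holds \<sigma> l)"
  let ?S = "\<lambda>M. obdd r V (\<lambda>\<sigma>. \<exists>I\<in>M. \<forall>l\<in>I. literal_holds \<sigma> l)"
  have lit: "obdd r V (\<lambda>\<sigma>. literal_holds \<sigma> l) \<in> obdds r V"
    "bdd_eval (obdd r V (\<lambda>\<sigma>. literal_holds \<sigma> l)) = (\<lambda>\<sigma>. literal_holds \<sigma> l)"
    if "l \<in> literals V" for l
    by (rule obdd_spec; use literal_holds_cong[OF that] in metis)+
  have cong: "(\<forall>l\<in>I. literal_holds \<sigma> l) \<longleftrightarrow> (\<forall>l\<in>I. literal_holds \<tau> l)"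
    if "I \<subseteq> literals V" "\<forall>v\<in>V. \<sigma> v = \<tau> v" for I \<sigma> \<tau>
    using that literal_holds_cong[of _ V \<sigma> \<tau>] by (intro ball_cong refl) blast
  have prod: "?P I \<in> obdds r V" "bdd_eval (?P I) = (\<lambda>\<sigma>. \<forall>l\<in>I. literal_holds \<sigma> l)"
    if "I \<subseteq> literals V" for I
    by (rule obdd_spec; rule cong[OF that]; assumption)+
  have sum: "?S M \<in> obdds r V" "bdd_eval (?S M) = (\<lambda>\<sigma>. \<exists>I\<in>M. \<forall>l\<in>I. literal_holds \<sigma> l)"
    if "M \<subseteq> Pow (literals V)" for M
    by (rule obdd_spec; intro bex_cong refl cong; use that in blast)+
  have "amc (obdd_sr r V) V T \<alpha> = ?S (models V T)"
  proof (rule amc_eqI[where S = ?S and P = ?P, OF commutative_semiring_obdd V])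
    \<comment> \<open>Replacing the inner diagrams by the functions that they evaluate to makes both
      sides \<open>obdd\<close> of the same function.\<close>
    show "?P (insert l J) = \<alpha> l \<otimes>\<^bsub>obdd_sr r V\<^esub> ?P J" if "l \<in> literals V" "J \<subseteq> literals V" for l J
      using that by (simp add: obdd_sr_def \<alpha> obdd_and_def lit prod)
    show "?S (insert I M) = ?P I \<oplus>\<^bsub>obdd_sr r V\<^esub> ?S M" if "I \<subseteq> literals V" "M \<subseteq> Pow (literals V)" for I M
      using that by (simp add: obdd_sr_def obdd_or_def sum prod)
  qed (auto simp: obdd_sr_def \<alpha> lit)
  thus ?thesis by (simp add: some_model_holds_iff[OF T])
qed

text \<open>Brings the label of a negative literal into the form
  \<open>obdd r V (\<lambda>\<sigma>. literal_holds \<sigma> l)\<close> that \<open>amc_obdd\<close>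
  expects.\<close>

lemma obdd_not_var:
  assumes "v \<in> V"
  shows "obdd_not r V (obdd r V (\<lambda>\<sigma>. \<sigma> v)) = obdd r V (\<lambda>\<sigma>. \<not> \<sigma> v)"
  unfolding obdd_not_def using assms by (subst obdd_spec(2)) auto

end

theorem theorem1:
  fixes V :: "'v set" and T :: "'v form set"
  assumes "finite V" and "theory_over V T"
  shows
    "\<comment> \<open>SAT\<close>
     (commutative_semiring bool_sr \<and>
      (\<forall>\<alpha>. (\<forall>v\<in>V. \<alpha> (Pos v) = True \<and> \<alpha> (Neg v) = True) \<longrightarrow>
        amc bool_sr V T \<alpha> = (models V T \<noteq> {}))) \<and>
     \<comment> \<open>#SAT\<close>
     (commutative_semiring nat_sr \<and>
      (\<forall>\<alpha>. (\<forall>v\<in>V. \<alpha> (Pos v) = 1 \<and> \<alpha> (Neg v) = 1) \<longrightarrow>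
        amc nat_sr V T \<alpha> = card (models V T))) \<and>
     \<comment> \<open>WMC\<close>
     (commutative_semiring nonneg_sr \<and>
      (\<forall>\<alpha>. (\<forall>v\<in>V. \<alpha> (Pos v) \<ge> 0 \<and> \<alpha> (Neg v) \<ge> 0) \<longrightarrow>
        amc nonneg_sr V T \<alpha> = (\<Sum>I\<in>models V T. \<Prod>l\<in>I. \<alpha> l))) \<and>
     \<comment> \<open>PROB\<close>
     (commutative_semiring nonneg_sr \<and>
      (\<forall>\<alpha>. (\<forall>v\<in>V. \<alpha> (Pos v) \<in> {0..1} \<and> \<alpha> (Neg v) = 1 - \<alpha> (Pos v)) \<longrightarrow>
        amc nonneg_sr V T \<alpha> = prob_holds V T (\<lambda>v. \<alpha> (Pos v)))) \<and>
     \<comment> \<open>SENS\<close>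
     (commutative_semiring (poly_sr V) \<and>
      (\<forall>S p \<alpha>. S \<subseteq> V \<and>
          (\<forall>v\<in>S. \<alpha> (Pos v) = pvar v) \<and>
          (\<forall>v\<in>V - S. p v \<in> {0..1} \<and> \<alpha> (Pos v) = pconst (p v)) \<and>
          (\<forall>v\<in>V. \<alpha> (Neg v) = 1 - \<alpha> (Pos v)) \<longrightarrow>
        (\<forall>q. is_prob_poly V T S p q \<longleftrightarrow> q = amc (poly_sr V) V T \<alpha>))) \<and>
     \<comment> \<open>GRAD\<close>
     (commutative_semiring grad_sr \<and>
      (\<forall>k\<in>V. \<forall>p \<alpha>. (\<forall>v\<in>V. p v \<in> {0..1}) \<and>
          \<alpha> (Pos k) = (p k, 1) \<and> \<alpha> (Neg k) = (1 - p k, - 1) \<and>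
          (\<forall>v\<in>V - {k}. \<alpha> (Pos v) = (p v, 0) \<and> \<alpha> (Neg v) = (1 - p v, 0)) \<longrightarrow>
        is_prob_grad V T p k (amc grad_sr V T \<alpha>))) \<and>
     \<comment> \<open>MPE\<close>
     (commutative_semiring max_times_sr \<and>
      (\<forall>\<alpha>. (\<forall>v\<in>V. \<alpha> (Pos v) \<in> {0..1} \<and> \<alpha> (Neg v) = 1 - \<alpha> (Pos v)) \<longrightarrow>
        amc max_times_sr V T \<alpha> = mpe_value V T (\<lambda>v. \<alpha> (Pos v)))) \<and>
     \<comment> \<open>S-PATH\<close>
     (commutative_semiring min_plus_sr \<and>
      (\<forall>(G :: ('n, 'v) pre_digraph) s t \<alpha>.
          fin_digraph G \<and> arcs G = V \<and> s \<in> verts G \<and> t \<in> verts G \<and> s \<noteq> t \<and>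
          is_path_theory G s t T \<and>
          (\<forall>v\<in>V. \<alpha> (Pos v) \<in> range enat \<and> \<alpha> (Neg v) = 0) \<longrightarrow>
        amc min_plus_sr V T \<alpha> = shortest {p. pre_digraph.apath G s p t} (\<lambda>v. \<alpha> (Pos v)) \<and>
        amc min_plus_sr V T \<alpha> = shortest {p. pre_digraph.awalk G s p t} (\<lambda>v. \<alpha> (Pos v)))) \<and>
     \<comment> \<open>W-PATH\<close>
     (commutative_semiring max_min_sr \<and>
      (\<forall>(G :: ('n, 'v) pre_digraph) s t \<alpha>.
          fin_digraph G \<and> arcs G = V \<and> s \<in> verts G \<and> t \<in> verts G \<and> s \<noteq> t \<and>
          is_path_theory G s t T \<and>
          (\<forall>v\<in>V. \<alpha> (Pos v) \<in> range enat \<and> \<alpha> (Neg v) = \<infinity>) \<longrightarrow>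
        amc max_min_sr V T \<alpha> = widest {p. pre_digraph.apath G s p t} (\<lambda>v. \<alpha> (Pos v)) \<and>
        amc max_min_sr V T \<alpha> = widest {p. pre_digraph.awalk G s p t} (\<lambda>v. \<alpha> (Pos v)))) \<and>
     \<comment> \<open>FUZZY\<close>
     (commutative_semiring fuzzy_sr \<and>
      (\<forall>\<alpha>. (\<forall>v\<in>V. \<alpha> (Pos v) \<in> {0..1} \<and> \<alpha> (Neg v) = 1) \<longrightarrow>
        amc fuzzy_sr V T \<alpha> = fuzzy_value V T (\<lambda>v. \<alpha> (Pos v)))) \<and>
     \<comment> \<open>kWEIGHT\<close>
     (\<forall>k. commutative_semiring (kweight_sr k) \<and>
      (\<forall>\<alpha>. (\<forall>v\<in>V. \<alpha> (Pos v) \<in> {0..k} \<and> \<alpha> (Neg v) \<in> {0..k}) \<longrightarrow>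
        amc (kweight_sr k) V T \<alpha> = kweight_value k V T \<alpha>)) \<and>
     \<comment> \<open>OBDD\<close>
     (\<forall>r. strict_linear_order_on V r \<longrightarrow>
      commutative_semiring (obdd_sr r V) \<and>
      (\<forall>\<alpha>. (\<forall>v\<in>V. \<alpha> (Pos v) = obdd r V (\<lambda>\<sigma>. \<sigma> v) \<and>
                  \<alpha> (Neg v) = obdd_not r V (obdd r V (\<lambda>\<sigma>. \<sigma> v))) \<longrightarrow>
        amc (obdd_sr r V) V T \<alpha> = obdd r V (theory_holds T)))"
proof (intro conjI allI impI ballI; (elim conjE)?)
  note V = assms(1)
  show "amc bool_sr V T \<alpha> = (models V T \<noteq> {})"
    if \<alpha>: "\<forall>v\<in>V. \<alpha> (Pos v) = True \<and> \<alpha> (Neg v) = True" for \<alpha>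
  proof -
    have "\<alpha> l" if "I \<in> models V T" "l \<in> I" for I l
      using models_literals[OF that] \<alpha> by (auto simp: literals_def)
    thus ?thesis by (auto simp: amc_bool[OF V])
  qed
  show "amc nat_sr V T \<alpha> = card (models V T)"
    if \<alpha>: "\<forall>v\<in>V. \<alpha> (Pos v) = 1 \<and> \<alpha> (Neg v) = 1" for \<alpha>
  proof -
    have "\<alpha> l = 1" if "I \<in> models V T" "l \<in> I" for I l
      using models_literals[OF that] \<alpha> by (auto simp: literals_def)
    thus ?thesis by (simp add: amc_nat[OF V])
  qed
  show "amc nonneg_sr V T \<alpha> = (\<Sum>I\<in>models V T. \<Prod>l\<in>I. \<alpha> l)"
    if "\<forall>v\<in>V. \<alpha> (Pos v) \<ge> 0 \<and> \<alpha> (Neg v) \<ge> 0" for \<alpha>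
    using that by (intro amc_nonneg V) (auto simp: literals_def)
  show "amc nonneg_sr V T \<alpha> = prob_holds V T (\<lambda>v. \<alpha> (Pos v))"
    if "\<forall>v\<in>V. \<alpha> (Pos v) \<in> {0..1} \<and> \<alpha> (Neg v) = 1 - \<alpha> (Pos v)" for \<alpha>
  proof -
    have "amc nonneg_sr V T \<alpha> = (\<Sum>I\<in>models V T. \<Prod>l\<in>I. \<alpha> l)"
      using that by (intro amc_nonneg V) (auto simp: literals_def)
    also have "\<dots> = prob_holds V T (\<lambda>v. \<alpha> (Pos v))"
      using that by (intro prob_holds_eq_sum[symmetric] V) auto
    finally show ?thesis .
  qed
  show "is_prob_poly V T S p q \<longleftrightarrow> q = amc (poly_sr V) V T \<alpha>"
    if "S \<subseteq> V" "\<forall>v\<in>S. \<alpha> (Pos v) = pvar v"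
      "\<forall>v\<in>V - S. p v \<in> {0..1} \<and> \<alpha> (Pos v) = pconst (p v)"
      "\<forall>v\<in>V. \<alpha> (Neg v) = 1 - \<alpha> (Pos v)" for S p \<alpha> q
  proof -
    have "is_prob_poly V T S p (amc (poly_sr V) V T \<alpha>)"
      using that by (intro is_prob_poly_amc_poly V) auto
    thus ?thesis using is_prob_poly_unique finite_subset[OF that(1) V] by metis
  qed
  show "is_prob_grad V T p k (amc grad_sr V T \<alpha>)"
    if "\<forall>v\<in>V. p v \<in> {0..1}" "\<alpha> (Pos k) = (p k, 1)" "\<alpha> (Neg k) = (1 - p k, - 1)"
      "\<forall>v\<in>V - {k}. \<alpha> (Pos v) = (p v, 0) \<and> \<alpha> (Neg v) = (1 - p v, 0)" for k p \<alpha>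
    using that by (intro is_prob_grad_amc_grad V) auto
  show "amc max_times_sr V T \<alpha> = mpe_value V T (\<lambda>v. \<alpha> (Pos v))"
    if "\<forall>v\<in>V. \<alpha> (Pos v) \<in> {0..1} \<and> \<alpha> (Neg v) = 1 - \<alpha> (Pos v)" for \<alpha>
    using that by (intro amc_mpe_value V) auto
  \<comment> \<open>Both path tasks are proved under one instance of
    \<open>path_problem\<close>.\<close>
  fix G :: "('n, 'v) pre_digraph" and s t
  assume G: "fin_digraph G" "arcs G = V" "s \<noteq> t" "is_path_theory G s t T"
  then interpret path_problem G s t T
    by (simp add: path_problem_def path_problem_axioms_def)
  show "amc min_plus_sr V T \<alpha> = shortest {p. apath s p t} (\<lambda>v. \<alpha> (Pos v))"
    "amc min_plus_sr V T \<alpha> = shortest {p. awalk s p t} (\<lambda>v. \<alpha> (Pos v))"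
    if "\<forall>v\<in>V. \<alpha> (Pos v) \<in> range enat \<and> \<alpha> (Neg v) = 0" for \<alpha>
    using amc_shortest[of \<alpha>] that by (simp_all add: G shortest_awalk)
  show "amc max_min_sr V T \<alpha> = widest {p. apath s p t} (\<lambda>v. \<alpha> (Pos v))"
    "amc max_min_sr V T \<alpha> = widest {p. awalk s p t} (\<lambda>v. \<alpha> (Pos v))"
    if "\<forall>v\<in>V. \<alpha> (Pos v) \<in> range enat \<and> \<alpha> (Neg v) = \<infinity>" for \<alpha>
    using amc_widest[of \<alpha>] that by (simp_all add: G widest_awalk)
next
  note V = assms(1)
  show "amc fuzzy_sr V T \<alpha> = fuzzy_value V T (\<lambda>v. \<alpha> (Pos v))"
    if "\<forall>v\<in>V. \<alpha> (Pos v) \<in> {0..1} \<and> \<alpha> (Neg v) = 1" for \<alpha>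
    using that by (intro amc_fuzzy_value V) auto
  show "amc (kweight_sr k) V T \<alpha> = kweight_value k V T \<alpha>"
    if "\<forall>v\<in>V. \<alpha> (Pos v) \<in> {0..k} \<and> \<alpha> (Neg v) \<in> {0..k}" for k \<alpha>
    using that by (intro amc_kweight V) (auto simp: literals_def)
  fix r :: "('v \<times> 'v) set"
  assume r: "strict_linear_order_on V r"
  show "commutative_semiring (obdd_sr r V)" by (rule commutative_semiring_obdd[OF V r])
  show "amc (obdd_sr r V) V T \<alpha> = obdd r V (theory_holds T)"
    if "\<forall>v\<in>V. \<alpha> (Pos v) = obdd r V (\<lambda>\<sigma>. \<sigma> v) \<and>
      \<alpha> (Neg v) = obdd_not r V (obdd r V (\<lambda>\<sigma>. \<sigma> v))" for \<alpha>
    using that by (intro amc_obdd[OF V r assms(2)]) (auto simp: literals_def obdd_not_var[OF V r])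
qed (fact commutative_semiring_bool commutative_semiring_nat commutative_semiring_nonneg
    commutative_semiring_poly commutative_semiring_grad commutative_semiring_max_times
    commutative_semiring_min_plus commutative_semiring_max_min commutative_semiring_fuzzy
    commutative_semiring_kweight)+

end
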